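(* Let $r\ge 2$ be a fixed integer and let $F_r=F(A)$ be the free group over an alphabet $A$ with $r$ letters. Generically, the finitely presented group $\langle A\mid \Gamma\rangle$ is trivial. In other words, the probability that the normal closure in $F_r$ of a randomly chosen subgroup of $F_r$ of size $n$ (chosen uniformly among the finitely many subgroups of size $n$) is $F_r$ itself tends to $1$ when $n$ tends to infinity.
   Context: Let $A$ be an alphabet with $r$ letters. An $A$-graph is a pair $\Gamma=(V,E)$ with $E\subseteq V\times A\times V$ such that $(u,a,v),(u,a,v')\in E$ implies $v=v'$, and $(u,a,v),(u',a,v)\in E$ implies $u=u'$. It is connected if its underlying undirected graph is connected. A vertex is a leaf if it occurs at most once in the list of triples defining $E$. A pair $(\Gamma,1)$, with $1$ a distinguished vertex of $\Gamma$, is admissible if $\Gamma$ is a finite connected $A$-graph in which no vertex other than $1$ is a leaf. Each finitely generated subgroup $H$ of $F(A)$ corresponds to a unique (up to isomorphism) admissible pair $(\Gamma(H),1)$, its Stallings graph, such that a reduced word $u$ is in $H$ if and only if $u$ labels a loop at $1$ (an edge $(x,a,y)$ being read from $x$ to $y$ with label $a$ or from $y$ to $x$ with label $a^{-1}$); conversely every admissible pair is the Stallings graph of a unique finitely generated subgroup. The size of $H$ is the number of vertices of $\Gamma(H)$; there are finitely many subgroups of each size. A random subgroup of size $n$ is taken with respect to the uniform distribution on subgroups of size $n$ (the graph-based distribution). If $\Gamma=\Gamma(H)$ is a Stallings graph, $\langle A\mid\Gamma\rangle$ denotes the quotient group $F(A)/N(H)$, where $N(H)$ is the normal closure of $H$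 in $F(A)$. "Generically" means with probability tending to $1$ as the size $n$ tends to infinity. *)

theory Defs
  imports "HOL-Algebra.Algebra" "HOL-Probability.Probability"
begin

section \<open>The free group\<close>

text \<open>A letter is a pair: \<open>(a, True)\<close> stands for \<open>a\<close> and \<open>(a, False)\<close> for its formal inverse. The
  elements of the free group on \<open>A\<close> are the reduced words.\<close>

type_synonym 'a word = "('a \<times> bool) list"

definition inv_letter :: "'a \<times> bool \<Rightarrow> 'a \<times> bool" where
  "inv_letter x = (fst x, \<not> snd x)"

definition reduced :: "'a word \<Rightarrow> bool" where
  "reduced w \<longleftrightarrow> successively (\<lambda>x y. y \<noteq> inv_letter x) w"

definition lmult :: "'a \<times> bool \<Rightarrow> 'a word \<Rightarrow> 'a word" where
  "lmult x w = (case w of [] \<Rightarrow> [x] | y # ys \<Rightarrow> if y = inv_letter x then ys else x # w)"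

text \<open>For reduced \<open>v\<close>, \<open>foldr lmult u v\<close> is the reduced form of the concatenation \<open>u @ v\<close>.\<close>

definition free_group :: "'a set \<Rightarrow> 'a word monoid" where
  "free_group A = \<lparr> carrier = {w. set w \<subseteq> A \<times> UNIV \<and> reduced w},
                    monoid.mult = (\<lambda>u v. foldr lmult u v),
                    one = [] \<rparr>"

lemma inv_letter_idem [simp]: "inv_letter (inv_letter x) = x"
  by (simp add: inv_letter_def)

lemma inv_letter_neq [simp]: "inv_letter x \<noteq> x"
  by (metis inv_letter_def snd_conv)

lemma reduced_Nil [simp]: "reduced []"
  by (simp add: reduced_def)

lemma reduced_Cons: "reduced (x # w) \<longleftrightarrow> reduced w \<and> (w = [] \<or> hd w \<noteq> inv_letter x)"
  by (auto simp: reduced_def successively_Cons)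

lemma reduced_lmult: "reduced w \<Longrightarrow> reduced (lmult x w)"
  by (auto simp: lmult_def reduced_Cons split: list.splits)

lemma reduced_foldr_lmult: "reduced v \<Longrightarrow> reduced (foldr lmult u v)"
  by (induction u) (auto intro: reduced_lmult)

lemma lmult_cancel: "reduced w \<Longrightarrow> lmult x (lmult (inv_letter x) w) = w"
  by (auto simp: lmult_def reduced_Cons split: list.splits)

lemma foldr_lmult_reduced: "reduced w \<Longrightarrow> foldr lmult w [] = w"
  by (induction w) (auto simp: reduced_Cons lmult_def split: list.splits)

lemma foldr_lmult_lmult:
  assumes "reduced w"
  shows "foldr lmult (lmult x v) w = lmult x (foldr lmult v w)"
  using assms by (auto simp: lmult_def[of x v] lmult_cancel reduced_foldr_lmult split: list.splits)

lemma foldr_lmult_assoc: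
  "reduced w \<Longrightarrow> foldr lmult (foldr lmult u v) w = foldr lmult u (foldr lmult v w)"
  by (induction u) (auto simp: foldr_lmult_lmult)

lemma foldr_lmult_inverse:
  "reduced w \<Longrightarrow> foldr lmult (rev (map inv_letter u)) (foldr lmult u w) = w"
proof (induction u arbitrary: w)
  case (Cons x u)
  then show ?case
    using lmult_cancel[of "foldr lmult u w" "inv_letter x"]
    by (simp add: reduced_foldr_lmult)
qed simp

lemma set_foldr_lmult: "set (foldr lmult u v) \<subseteq> set u \<union> set v"
proof (induction u)
  case (Cons x u)
  then show ?case by (auto simp: lmult_def split: list.splits if_splits)
qed simp

lemma group_free_group: "group (free_group A)"
proof (rule groupI)
  fix u v assume "u \<in> carrier (free_group A)" "v \<in> carrier (free_group A)"
  then show "u \<otimes>\<^bsub>free_group A\<^esub> v \<in> carrier (free_group A)"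
    using set_foldr_lmult[of u v] by (auto simp: free_group_def intro: reduced_foldr_lmult)
next
  fix u assume u: "u \<in> carrier (free_group A)"
  let ?v = "foldr lmult (rev (map inv_letter u)) []"
  have "?v \<in> carrier (free_group A)"
    using u set_foldr_lmult[of "rev (map inv_letter u)" "[]"]
    by (fastforce simp: free_group_def inv_letter_def intro: reduced_foldr_lmult)
  moreover have "?v \<otimes>\<^bsub>free_group A\<^esub> u = \<one>\<^bsub>free_group A\<^esub>"
    using u foldr_lmult_inverse[of "[]" u]
    by (simp add: free_group_def foldr_lmult_assoc foldr_lmult_reduced)
  ultimately show "\<exists>v\<in>carrier (free_group A). v \<otimes>\<^bsub>free_group A\<^esub> u = \<one>\<^bsub>free_group A\<^esub>"
    by blast
qed (auto simp: free_group_def foldr_lmult_assoc)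

definition finitely_generated_subgroup :: "('g, 'm) monoid_scheme \<Rightarrow> 'g set \<Rightarrow> bool" where
  "finitely_generated_subgroup G H \<longleftrightarrow>
     (\<exists>S. finite S \<and> S \<subseteq> carrier G \<and> H = generate G S)"

definition normal_closure :: "('g, 'm) monoid_scheme \<Rightarrow> 'g set \<Rightarrow> 'g set" where
  "normal_closure G S = \<Inter> {N. N \<lhd> G \<and> S \<subseteq> N}"

section \<open>Stallings graphs\<close>

definition A_graph :: "'a set \<Rightarrow> 'v set \<Rightarrow> ('v \<times> 'a \<times> 'v) set \<Rightarrow> bool" where
  "A_graph A V E \<longleftrightarrow> E \<subseteq> V \<times> A \<times> V \<and>
     (\<forall>u a v v'. (u, a, v) \<in> E \<longrightarrow> (u, a, v') \<in> E \<longrightarrow> v = v') \<and>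
     (\<forall>u u' a v. (u, a, v) \<in> E \<longrightarrow> (u', a, v) \<in> E \<longrightarrow> u = u')"

definition adjacent :: "('v \<times> 'a \<times> 'v) set \<Rightarrow> ('v \<times> 'v) set" where
  "adjacent E = {(x, y). \<exists>a. (x, a, y) \<in> E \<or> (y, a, x) \<in> E}"

definition connected_graph :: "'v set \<Rightarrow> ('v \<times> 'a \<times> 'v) set \<Rightarrow> bool" where
  "connected_graph V E \<longleftrightarrow> (\<forall>x\<in>V. \<forall>y\<in>V. (x, y) \<in> (adjacent E)\<^sup>*)"

text \<open>A loop \<open>(v, a, v)\<close> contributes two occurrences of \<open>v\<close>.\<close>

definition occurrences :: "('v \<times> 'a \<times> 'v) set \<Rightarrow> 'v \<Rightarrow> nat" where
  "occurrences E v = card {(x, a, y) \<in> E. x = v} + card {(x, a, y) \<in> E. y = v}"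

definition leaf :: "('v \<times> 'a \<times> 'v) set \<Rightarrow> 'v \<Rightarrow> bool" where
  "leaf E v \<longleftrightarrow> occurrences E v \<le> 1"

definition admissible :: "'a set \<Rightarrow> 'v set \<Rightarrow> ('v \<times> 'a \<times> 'v) set \<Rightarrow> 'v \<Rightarrow> bool" where
  "admissible A V E b \<longleftrightarrow> finite V \<and> b \<in> V \<and> A_graph A V E \<and> connected_graph V E \<and>
     (\<forall>v\<in>V. v \<noteq> b \<longrightarrow> \<not> leaf E v)"

fun edge_step :: "('v \<times> 'a \<times> 'v) set \<Rightarrow> 'v \<Rightarrow> 'a \<times> bool \<Rightarrow> 'v \<Rightarrow> bool" where
  "edge_step E x (a, True) y \<longleftrightarrow> (x, a, y) \<in> E"
| "edge_step E x (a, False) y \<longleftrightarrow> (y, a, x) \<in> E"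

fun labels_path :: "('v \<times> 'a \<times> 'v) set \<Rightarrow> 'v \<Rightarrow> 'a word \<Rightarrow> 'v \<Rightarrow> bool" where
  "labels_path E x [] y \<longleftrightarrow> x = y"
| "labels_path E x (l # w) y \<longleftrightarrow> (\<exists>z. edge_step E x l z \<and> labels_path E z w y)"

definition stallings_graph ::
  "'a set \<Rightarrow> 'v set \<Rightarrow> ('v \<times> 'a \<times> 'v) set \<Rightarrow> 'v \<Rightarrow> 'a word set \<Rightarrow> bool" where
  "stallings_graph A V E b H \<longleftrightarrow> admissible A V E b \<and>
     (\<forall>u \<in> carrier (free_group A). u \<in> H \<longleftrightarrow> labels_path E b u b)"

section \<open>Random subgroups\<close>

text \<open>The size of a subgroup is the number of vertices of its Stallings graph, which is finite and
  unique up to isomorphism; natural numbers therefore suffice as vertices.\<close>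

definition subgroups_of_size :: "'a set \<Rightarrow> nat \<Rightarrow> 'a word set set" where
  "subgroups_of_size A n =
     {H. subgroup H (free_group A) \<and> finitely_generated_subgroup (free_group A) H \<and>
         (\<exists>(V :: nat set) E b. stallings_graph A V E b H \<and> card V = n)}"

text \<open>For a finite nonempty alphabet \<open>A\<close> and \<open>n > 0\<close>, the set \<open>subgroups_of_size A n\<close> is finite and nonempty,
  so \<open>pmf_of_set\<close> is the uniform distribution on it.\<close>

definition generically :: "'a set \<Rightarrow> ('a word set \<Rightarrow> bool) \<Rightarrow> bool" where
  "generically A P \<longleftrightarrow>
     (\<lambda>n. measure_pmf.prob (pmf_of_set (subgroups_of_size A n)) {H. P H}) \<longlonglongrightarrow> 1"

text \<open>The group presented by the Stallings graph of \<open>H\<close>, for a subgroup \<open>H\<close> of the free group.\<close>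

definition presented_group :: "'a set \<Rightarrow> 'a word set \<Rightarrow> 'a word set monoid" where
  "presented_group A H = free_group A Mod normal_closure (free_group A) H"

end

theory Submission
  imports Defs "HOL-Real_Asymp.Real_Asymp"
begin

text \<open>
  Choosing an \<open>A\<close>-graph on a fixed vertex set means choosing one partial injection of the vertices for
  every letter, independently. If the edges labelled \<open>a\<close> contain a cycle of length \<open>k\<close>, then a path
  from the base vertex to this cycle conjugates \<open>a\<^sup>k\<close> into the subgroup \<open>H\<close>, so \<open>a\<^sup>k\<close> lies in the normal
  closure of \<open>H\<close>. Two cycles of coprime lengths therefore put \<open>a\<close> itself into the normal closure, and
  if this happens for every letter, then the normal closure is the whole free group
  (\<open>normal_closure_loop_group\<close>). It remains to see that coprime cycle lengths are typical.

  For a single partial injection of \<open>n\<close> points this is a second moment argument. The number of cycles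
  whose length belongs to a finite set \<open>S\<close> has asymptotically mean and variance
  \<open>\<Sum>k\<in>S. 1 / k\<close>, so a cycle with length in \<open>S\<close> is very likely to exist when this sum is large
  (\<open>card_no_cycle_le\<close>). The harmonic series diverges along every arithmetic progression, so one can
  ask for one length in \<open>S = {2..K + 1}\<close> and another one that is \<open>1\<close> modulo a common multiple of \<open>S\<close>
  (\<open>card_not_coprime_cycles\<close>). The moments are computed from the fact that the numbers \<open>I\<^sub>n\<close> of partial
  injections satisfy \<open>n * I\<^sub>n\<^sub>-\<^sub>1 / I\<^sub>n \<longlonglongrightarrow> 1\<close>, and this in turn follows from a double counting which shows
  that a typical partial injection is undefined at only about \<open>sqrt n\<close> points
  (\<open>sum_defect_square_le\<close>).

  A random Stallings graph is a random tuple of partial injections conditioned on being admissible. At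
  least half of all tuples are connected and without leaves once \<open>n\<close> is large
  (\<open>card_connected_leafless_ge\<close>), so the conditioning at most doubles small probabilities. This is
  the place where at least two letters are required.

  Finally, graphs have to be exchanged for subgroups. The Stallings graph is determined by its subgroup up
  to a unique isomorphism (\<open>stallings_graph_unique\<close>, \<open>map_graph_rigid\<close>), so every subgroup of size
  \<open>n\<close> comes from exactly \<open>n!\<close> pointed graphs on \<open>n\<close> given vertices, and proportions among subgroups
  equal proportions among pointed graphs (\<open>card_pointed_graphs\<close>).
\<close>

section \<open>Partial injections\<close>

text \<open>A partial injection is represented by its graph, a set of pairs. This is the form in which the
  edges of one label appear in an \<open>A\<close>-graph.\<close>

definition pinj :: "'v set \<Rightarrow> ('v \<times> 'v) set set" where
  "pinj V = {f. f \<subseteq> V \<times> V \<and> single_valued f \<and> single_valued (f\<inverse>)}"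

lemma pinj_iff:
  "f \<in> pinj V \<longleftrightarrow> f \<subseteq> V \<times> V \<and> (\<forall>x y y'. (x, y) \<in> f \<longrightarrow> (x, y') \<in> f \<longrightarrow> y = y')
     \<and> (\<forall>x x' y. (x, y) \<in> f \<longrightarrow> (x', y) \<in> f \<longrightarrow> x = x')"
  unfolding pinj_def single_valued_def by auto

lemma pinjI:
  assumes "f \<subseteq> V \<times> V"
    and "\<And>x y y'. (x, y) \<in> f \<Longrightarrow> (x, y') \<in> f \<Longrightarrow> y = y'"
    and "\<And>x x' y. (x, y) \<in> f \<Longrightarrow> (x', y) \<in> f \<Longrightarrow> x = x'"
  shows "f \<in> pinj V"
  using assms unfolding pinj_iff by simp

lemma pinjD:
  assumes "f \<in> pinj V"
  shows "f \<subseteq> V \<times> V"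
    and "(x, y) \<in> f \<Longrightarrow> (x, y') \<in> f \<Longrightarrow> y = y'"
    and "(x, y) \<in> f \<Longrightarrow> (x', y) \<in> f \<Longrightarrow> x = x'"
  using assms unfolding pinj_iff by simp_all

lemma finite_pinj: "finite V \<Longrightarrow> finite (pinj V)"
  by (rule finite_subset[of _ "Pow (V \<times> V)"]) (auto simp: pinj_def)

lemma empty_in_pinj: "{} \<in> pinj V"
  by (rule pinjI) auto

lemma pinj_subset: "f \<in> pinj V \<Longrightarrow> g \<subseteq> f \<Longrightarrow> g \<in> pinj V"
  unfolding pinj_iff by (meson subset_iff subset_trans)

lemma card_pinj_le:
  assumes "finite V" "finite W" "card V \<le> card W"
  shows "card (pinj V) \<le> card (pinj W)"
proof -
  obtain h where h: "inj_on h V" "h ` V \<subseteq> W"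
    using card_le_inj[OF assms] by blast
  have "map_prod h h ` f \<in> pinj W" if "f \<in> pinj V" for f
  proof (rule pinjI)
    have V: "x \<in> V \<and> y \<in> V" if "(x, y) \<in> f" for x y
      using that pinjD(1)[OF \<open>f \<in> pinj V\<close>] by auto
    show "map_prod h h ` f \<subseteq> W \<times> W" using V h(2) by auto
    show "y = y'" if "(x, y) \<in> map_prod h h ` f" "(x, y') \<in> map_prod h h ` f" for x y y'
      using that V h(1) pinjD(2)[OF \<open>f \<in> pinj V\<close>] by (clarsimp simp: inj_on_eq_iff)
    show "x = x'" if "(x, y) \<in> map_prod h h ` f" "(x', y) \<in> map_prod h h ` f" for x x' y
      using that V h(1) pinjD(3)[OF \<open>f \<in> pinj V\<close>] by (clarsimp simp: inj_on_eq_iff)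
  qed
  moreover have "inj_on (\<lambda>f. map_prod h h ` f) (pinj V)"
  proof (rule inj_onI)
    fix f g assume fg: "f \<in> pinj V" "g \<in> pinj V" "map_prod h h ` f = map_prod h h ` g"
    have "inj_on (map_prod h h) (V \<times> V)"
      using h map_prod_inj_on by blast
    then show "f = g"
      using fg pinjD(1) by (metis inj_on_image_eq_iff)
  qed
  ultimately show ?thesis
    using assms(2) by (intro card_inj_on_le[OF _ _ finite_pinj]) auto
qed

lemma pinj_restrict: "f \<in> pinj V \<Longrightarrow> f \<subseteq> U \<times> U \<Longrightarrow> f \<in> pinj U"
  by (simp add: pinj_def)

lemma pinj_mono: "U \<subseteq> V \<Longrightarrow> pinj U \<subseteq> pinj V"
  unfolding pinj_def by blast

definition pinj_count :: "nat \<Rightarrow> nat" where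
  "pinj_count n = card (pinj {..<n})"

lemma card_pinj: "finite V \<Longrightarrow> card (pinj V) = pinj_count (card V)"
  unfolding pinj_count_def by (intro antisym card_pinj_le) auto

lemma pinj_count_pos: "pinj_count n > 0"
  unfolding pinj_count_def using empty_in_pinj finite_pinj by (metis card_gt_0_iff empty_iff finite_lessThan)

text \<open>Inserts \<open>v\<close> into the orbit structure of \<open>g\<close> directly behind
  \<open>w\<close>. For \<open>w = v\<close>, where \<open>v\<close> is isolated in \<open>g\<close>, the
  same formula creates a fixed point.\<close>

definition insert_after :: "'v \<Rightarrow> 'v \<Rightarrow> ('v \<times> 'v) set \<Rightarrow> ('v \<times> 'v) set" where
  "insert_after v w g = {(x, y) \<in> g. x \<noteq> w} \<union> {(w, v)} \<union> {(v, y) | y. (w, y) \<in> g}"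

text \<open>Every partial injection with \<open>v\<close> in its range arises in exactly one way from a
  partial injection of \<open>V - {v}\<close> by inserting \<open>v\<close> behind some
  \<open>w \<in> V\<close>; the inverse operation bypasses \<open>v\<close>.\<close>

lemma card_pinj_in_Range:
  assumes "finite V" "v \<in> V"
  shows "card {f \<in> pinj V. v \<in> Range f} = card V * card (pinj (V - {v}))"
proof -
  \<comment> \<open>The second part joins the predecessor of \<open>v\<close> to its successor; a loop at \<open>v\<close> simply disappears.\<close>
  define bypass where
    "bypass f = {(x, y) \<in> f. x \<noteq> v \<and> y \<noteq> v} \<union> {(w, y). (w, v) \<in> f \<and> (v, y) \<in> f \<and> y \<noteq> v}" for f
  have "bij_betw (\<lambda>(w, g). insert_after v w g) (V \<times> pinj (V - {v})) {f \<in> pinj V. v \<in> Range f}"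
  proof (rule bij_betw_byWitness[where f' = "\<lambda>f. (THE w. (w, v) \<in> f, bypass f)"])
    show "\<forall>p \<in> V \<times> pinj (V - {v}).
        (THE w. (w, v) \<in> (case p of (w, g) \<Rightarrow> insert_after v w g),
         bypass (case p of (w, g) \<Rightarrow> insert_after v w g)) = p"
    proof
      fix p assume "p \<in> V \<times> pinj (V - {v})"
      then obtain w g where p: "p = (w, g)" and "g \<in> pinj (V - {v})" by blast
      note g = pinjD[OF this(2)]
      have w: "(u, v) \<in> insert_after v w g \<longleftrightarrow> u = w" for u
        using g(1) by (auto simp: insert_after_def)
      then have "(THE u. (u, v) \<in> insert_after v w g) = w" by simp
      moreover have "bypass (insert_after v w g) = g"
        using g by (auto simp: bypass_def w) (auto simp: insert_after_def)
      ultimately show "(THE w. (w, v) \<in> (case p of (w, g) \<Rightarrow> insert_after v w g),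
         bypass (case p of (w, g) \<Rightarrow> insert_after v w g)) = p"
        by (simp add: p)
    qed
    show "\<forall>f \<in> {f \<in> pinj V. v \<in> Range f}.
        (case (THE w. (w, v) \<in> f, bypass f) of (w, g) \<Rightarrow> insert_after v w g) = f"
    proof
      fix f assume "f \<in> {f \<in> pinj V. v \<in> Range f}"
      then obtain w where "f \<in> pinj V" and w: "(w, v) \<in> f" by blast
      note f = pinjD[OF this(1)]
      have the: "(THE w. (w, v) \<in> f) = w" using w f by blast
      have "insert_after v w (bypass f) = f"
        using w f by (auto simp: insert_after_def bypass_def)
      then show "(case (THE w. (w, v) \<in> f, bypass f) of (w, g) \<Rightarrow> insert_after v w g) = f"
        by (simp add: the)
    qed
    show "(\<lambda>(w, g). insert_after v w g) ` (V \<times> pinj (V - {v})) \<subseteq> {f \<in> pinj V. v \<in> Range f}"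
    proof safe
      fix w g assume "g \<in> pinj (V - {v})" "w \<in> V"
      note g = pinjD[OF this(1)]
      show "insert_after v w g \<in> pinj V"
        using g \<open>w \<in> V\<close> assms(2) by (intro pinjI) (auto simp: insert_after_def)
      show "v \<in> Range (insert_after v w g)"
        by (auto simp: insert_after_def)
    qed
    show "(\<lambda>f. (THE w. (w, v) \<in> f, bypass f)) ` {f \<in> pinj V. v \<in> Range f} \<subseteq> V \<times> pinj (V - {v})"
    proof safe
      fix f w assume "f \<in> pinj V" and w: "(w, v) \<in> f"
      note f = pinjD[OF this(1)]
      have "(THE w. (w, v) \<in> f) = w" using w f by blast
      then show "(THE w. (w, v) \<in> f) \<in> V" using w f by auto
      show "bypass f \<in> pinj (V - {v})"
      proof (rule pinjI)
        show "bypass f \<subseteq> (V - {v}) \<times> (V - {v})"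
          using f by (auto simp: bypass_def)
      qed (use f in \<open>auto simp: bypass_def\<close>)
    qed
  qed
  then show ?thesis
    by (simp add: bij_betw_same_card[symmetric] card_cartesian_product)
qed

lemma card_Domain_pinj: "f \<in> pinj V \<Longrightarrow> card (Domain f) = card f"
  unfolding Domain_fst by (rule card_image) (auto intro!: inj_onI dest: pinjD)

lemma card_Range_pinj: "f \<in> pinj V \<Longrightarrow> card (Range f) = card f"
  unfolding Range_snd by (rule card_image) (auto intro!: inj_onI dest: pinjD)

lemma Domain_Range_pinj: "f \<in> pinj V \<Longrightarrow> Domain f \<subseteq> V \<and> Range f \<subseteq> V"
  by (auto dest: pinjD)

lemma card_le_pinj: "finite V \<Longrightarrow> f \<in> pinj V \<Longrightarrow> card f \<le> card V"
  using card_Domain_pinj[of f V] Domain_Range_pinj[of f V] by (metis card_mono)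

text \<open>The defect \<open>card V - card f\<close> counts the points without an image, and also the
  points without a preimage. Hence its square counts the ways to add one more pair to \<open>f\<close>. Each
  such extension yields a partial injection with a marked pair, and a partial injection has at most
  \<open>card V\<close> pairs to mark. So the defect is of order \<open>sqrt (card V)\<close> in quadratic
  mean, which is the source of all asymptotic estimates below.\<close>

lemma sum_defect_square_le:
  assumes "finite V"
  shows "(\<Sum>f\<in>pinj V. (card V - card f)\<^sup>2) \<le> card V * card (pinj V)"
proof -
  let ?P = "SIGMA f:pinj V. (V - Domain f) \<times> (V - Range f)"
  let ?Q = "SIGMA f:pinj V. f"
  have finf: "finite f" if "f \<in> pinj V" for f
    using that assms pinjD(1) finite_subset by (metis finite_SigmaI)
  have "(\<Sum>f\<in>pinj V. (card V - card f)\<^sup>2) = card ?P"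
  proof (subst card_SigmaI)
    show "(\<Sum>f\<in>pinj V. (card V - card f)\<^sup>2) = (\<Sum>f\<in>pinj V. card ((V - Domain f) \<times> (V - Range f)))"
    proof (rule sum.cong)
      fix f assume f: "f \<in> pinj V"
      then have "card (V - Domain f) = card V - card f" "card (V - Range f) = card V - card f"
        using card_Domain_pinj[OF f] card_Range_pinj[OF f] Domain_Range_pinj[OF f] assms
        by (metis card_Diff_subset finite_subset)+
      then show "(card V - card f)\<^sup>2 = card ((V - Domain f) \<times> (V - Range f))"
        by (simp add: card_cartesian_product power2_eq_square)
    qed simp
  qed (use assms finite_pinj in auto)
  also have "\<dots> \<le> card ?Q"
  proof (rule card_inj_on_le)
    let ?h = "\<lambda>(f, e). (insert e f, e)"
    show "inj_on ?h ?P"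
    proof (rule inj_onI)
      fix p q assume "p \<in> ?P" "q \<in> ?P" and "?h p = ?h q"
      then obtain f g e where pq: "p = (f, e)" "q = (g, e)" and "fst e \<notin> Domain f" "fst e \<notin> Domain g"
        and eq: "insert e f = insert e g"
        by auto
      then have "e \<notin> f" "e \<notin> g" by (metis DomainI prod.collapse)+
      then show "p = q" using eq pq insert_ident by metis
    qed
    show "?h ` ?P \<subseteq> ?Q"
    proof (rule image_subsetI)
      fix p assume "p \<in> ?P"
      then obtain f x y where p: "p = (f, (x, y))" and "f \<in> pinj V" "x \<in> V" "x \<notin> Domain f" "y \<in> V" "y \<notin> Range f"
        by blast
      then have "insert (x, y) f \<in> pinj V"
        by (intro pinjI) (auto dest: pinjD)
      then show "?h p \<in> ?Q" by (simp add: p)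
    qed
    show "finite ?Q" using assms finite_pinj finf by auto
  qed
  also have "card ?Q = (\<Sum>f\<in>pinj V. card f)"
    using assms finite_pinj finf by (intro card_SigmaI) auto
  also have "\<dots> \<le> (\<Sum>f\<in>pinj V. card V)"
    using card_le_pinj assms by (intro sum_mono) auto
  finally show ?thesis by (simp add: mult.commute)
qed

text \<open>The first moment follows from the second one by
  \<open>2 j s \<le> j\<^sup>2 + s\<^sup>2\<close> with \<open>s = sqrt (card V)\<close>.\<close>

lemma sum_defect_le:
  assumes "finite V"
  shows "(\<Sum>f\<in>pinj V. real (card V - card f)) \<le> sqrt (card V) * card (pinj V)"
proof (cases "card V = 0")
  case False
  let ?s = "sqrt (card V)"
  have s: "?s > 0" using False by simp
  have "2 * (\<Sum>f\<in>pinj V. real (card V - card f)) = (\<Sum>f\<in>pinj V. 2 * real (card V - card f))"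
    by (simp add: sum_distrib_left)
  also have "\<dots> \<le> (\<Sum>f\<in>pinj V. real ((card V - card f)\<^sup>2) / ?s + ?s)"
  proof (rule sum_mono)
    fix f
    let ?j = "real (card V - card f)"
    have "2 * ?j * ?s \<le> ?j\<^sup>2 + ?s\<^sup>2"
      using sum_squares_bound[of ?j ?s] by simp
    then show "2 * ?j \<le> real ((card V - card f)\<^sup>2) / ?s + ?s"
      using s by (simp add: field_simps power2_eq_square)
  qed
  also have "\<dots> = real (\<Sum>f\<in>pinj V. (card V - card f)\<^sup>2) / ?s + ?s * card (pinj V)"
    by (simp add: sum.distrib sum_divide_distrib)
  also have "\<dots> \<le> real (card V * card (pinj V)) / ?s + ?s * card (pinj V)"
    using sum_defect_square_le[OF assms] s
    by (intro add_right_mono divide_right_mono of_nat_mono) auto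
  also have "real (card V * card (pinj V)) / ?s = ?s * card (pinj V)"
    using s by (simp add: field_simps)
  finally show ?thesis by (simp add: mult.commute)
qed simp

lemma sum_card_notin_Range:
  assumes "finite V"
  shows "(\<Sum>v\<in>V. real (card {f \<in> pinj V. v \<notin> Range f})) \<le> sqrt (card V) * card (pinj V)"
    and "(\<Sum>v\<in>V. real (card {f \<in> pinj V. v \<notin> Domain f})) \<le> sqrt (card V) * card (pinj V)"
proof -
  have swap: "(\<Sum>v\<in>V. real (card {f \<in> pinj V. v \<notin> D f})) = (\<Sum>f\<in>pinj V. real (card V - card f))"
    if D: "\<And>f. f \<in> pinj V \<Longrightarrow> D f \<subseteq> V \<and> card (D f) = card f" for D :: "('a \<times> 'a) set \<Rightarrow> 'a set"
  proof -
    have "(\<Sum>v\<in>V. real (card {f \<in> pinj V. v \<notin> D f})) = (\<Sum>f\<in>pinj V. real (card {v \<in> V. v \<notin> D f}))"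
      using sum_multicount_gen[OF assms finite_pinj[OF assms],
          of "\<lambda>v f. v \<notin> D f" "\<lambda>f. card {v \<in> V. v \<notin> D f}"]
      by (simp flip: of_nat_sum)
    also have "\<dots> = (\<Sum>f\<in>pinj V. real (card V - card f))"
    proof (rule sum.cong)
      fix f assume f: "f \<in> pinj V"
      have "{v \<in> V. v \<notin> D f} = V - D f" by auto
      then show "real (card {v \<in> V. v \<notin> D f}) = real (card V - card f)"
        using D[OF f] assms by (metis card_Diff_subset finite_subset)
    qed simp
    finally show ?thesis .
  qed
  show "(\<Sum>v\<in>V. real (card {f \<in> pinj V. v \<notin> Range f})) \<le> sqrt (card V) * card (pinj V)"
    using swap[of Range, OF conjI] sum_defect_le[OF assms] card_Range_pinj Domain_Range_pinj by fastforce
  show "(\<Sum>v\<in>V. real (card {f \<in> pinj V. v \<notin> Domain f})) \<le> sqrt (card V) * card (pinj V)"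
    using swap[of Domain, OF conjI] sum_defect_le[OF assms] card_Domain_pinj Domain_Range_pinj by fastforce
qed

lemma pinj_count_Suc_ge: "Suc n * pinj_count n \<le> pinj_count (Suc n)"
proof -
  have "Suc n * pinj_count n = card {f \<in> pinj {..<Suc n}. n \<in> Range f}"
    by (subst card_pinj_in_Range) (auto simp: card_pinj)
  also have "\<dots> \<le> card (pinj {..<Suc n})"
    by (intro card_mono finite_pinj) auto
  finally show ?thesis by (simp add: pinj_count_def)
qed

text \<open>By symmetry every point is missing from the range of a random partial injection with the same
  probability, and by the bound on the defect these probabilities add up to at most
  \<open>sqrt (Suc n)\<close>. The complementary event was counted by insertion of the point.\<close>

lemma pinj_count_Suc_le:
  "(1 - 1 / sqrt (Suc n)) * pinj_count (Suc n) \<le> Suc n * pinj_count n"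
proof -
  let ?V = "{..<Suc n}" and ?s = "sqrt (Suc n)"
  have compl: "real (card {f \<in> pinj ?V. v \<notin> Range f}) = pinj_count (Suc n) - real (Suc n * pinj_count n)"
    if "v \<in> ?V" for v
  proof -
    have "card (pinj ?V) = card {f \<in> pinj ?V. v \<in> Range f} + card {f \<in> pinj ?V. v \<notin> Range f}"
      by (subst card_Un_disjoint[symmetric]) (auto intro!: arg_cong[where f = card] finite_subset[OF _ finite_pinj[of ?V]])
    also have "card {f \<in> pinj ?V. v \<in> Range f} = Suc n * pinj_count n"
      using that by (subst card_pinj_in_Range) (auto simp: card_pinj)
    finally show ?thesis by (simp add: pinj_count_def)
  qed
  have "(\<Sum>v\<in>?V. real (card {f \<in> pinj ?V. v \<notin> Range f}))
      = real (Suc n) * (pinj_count (Suc n) - real (Suc n * pinj_count n))"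
    by (subst sum.cong[OF refl compl]) auto
  moreover have "\<dots> \<le> ?s * pinj_count (Suc n)"
    using calculation sum_card_notin_Range(1)[of ?V] by (simp add: pinj_count_def)
  moreover have "real (Suc n) = ?s * ?s" by simp
  ultimately have "?s * (?s * (pinj_count (Suc n) - real (Suc n * pinj_count n))) \<le> ?s * pinj_count (Suc n)"
    by (metis mult.assoc)
  then have "?s * (pinj_count (Suc n) - real (Suc n * pinj_count n)) \<le> pinj_count (Suc n)"
    by (subst (asm) mult_le_cancel_left_pos) simp_all
  then show ?thesis by (simp add: field_simps)
qed

text \<open>The coefficients of the exponential generating function of partial injections. They grow like
  \<open>exp (2 * sqrt n)\<close> up to a power of \<open>n\<close>; the estimates below rest on their
  monotonicity and on the convergence of successive ratios to \<open>1\<close>.\<close>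

definition pinj_density :: "nat \<Rightarrow> real" where
  "pinj_density n = pinj_count n / fact n"

lemma pinj_density_pos: "pinj_density n > 0"
  by (simp add: pinj_density_def pinj_count_pos)

lemma pinj_density_Suc: "pinj_density n \<le> pinj_density (Suc n)"
proof -
  have "real (Suc n * pinj_count n) \<le> pinj_count (Suc n)"
    using pinj_count_Suc_ge of_nat_mono by blast
  then have "fact n * real (Suc n * pinj_count n) \<le> fact n * real (pinj_count (Suc n))"
    by (intro mult_left_mono) auto
  moreover have "real (fact (Suc n)) = fact n * real (Suc n)" by (simp add: algebra_simps)
  ultimately show ?thesis
    by (simp add: pinj_density_def divide_simps) (simp add: algebra_simps)
qed

lemma pinj_density_mono: "m \<le> n \<Longrightarrow> pinj_density m \<le> pinj_density n"
  using pinj_density_Suc by (rule lift_Suc_mono_le)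

lemma pinj_density_Suc_le: "(1 - 1 / sqrt (Suc n)) * pinj_density (Suc n) \<le> pinj_density n"
proof -
  have "(1 - 1 / sqrt (Suc n)) * pinj_density (Suc n)
      = (1 - 1 / sqrt (Suc n)) * pinj_count (Suc n) / fact (Suc n)"
    by (simp add: pinj_density_def)
  also have "\<dots> \<le> Suc n * pinj_count n / fact (Suc n)"
    by (intro divide_right_mono) (use pinj_count_Suc_le[of n] in auto)
  also have "\<dots> = pinj_density n"
    by (simp add: pinj_density_def divide_simps) (simp add: algebra_simps)
  finally show ?thesis .
qed

lemma pinj_density_ratio: "(\<lambda>n. pinj_density n / pinj_density (n + k)) \<longlonglongrightarrow> 1"
proof (induction k)
  case 0
  have "pinj_density n / pinj_density n = 1" for n
    using pinj_density_pos[of n] by simp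
  then show ?case by simp
next
  case (Suc k)
  have one: "(\<lambda>n. pinj_density n / pinj_density (Suc n)) \<longlonglongrightarrow> 1"
  proof (rule real_tendsto_sandwich)
    show "\<forall>\<^sub>F n in sequentially. 1 - 1 / sqrt (Suc n) \<le> pinj_density n / pinj_density (Suc n)"
      using pinj_density_Suc_le pinj_density_pos by (simp add: pos_le_divide_eq)
    show "\<forall>\<^sub>F n in sequentially. pinj_density n / pinj_density (Suc n) \<le> 1"
      using pinj_density_Suc pinj_density_pos by (simp add: pos_divide_le_eq)
    show "(\<lambda>n. 1 - 1 / sqrt (Suc n)) \<longlonglongrightarrow> 1"
      by real_asymp
  qed auto
  have "(\<lambda>n. pinj_density n / pinj_density (n + k) * (pinj_density (n + k) / pinj_density (Suc (n + k)))) \<longlonglongrightarrow> 1 * 1"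
    using Suc LIMSEQ_ignore_initial_segment[OF one, of k] by (intro tendsto_mult) auto
  then show ?case
    using pinj_density_pos by (simp add: less_imp_neq[symmetric])
qed

lemma pinj_density_subexponential:
  assumes "q > 1"
  obtains C where "C > 0" "\<And>n. pinj_density n \<le> C * q ^ n"
proof -
  have "eventually (\<lambda>n. 1 / q < pinj_density n / pinj_density (n + 1)) sequentially"
    using assms by (intro order_tendstoD(1)[OF pinj_density_ratio]) (simp add: field_simps)
  then obtain N where N: "\<And>n. n \<ge> N \<Longrightarrow> 1 / q < pinj_density n / pinj_density (n + 1)"
    unfolding eventually_sequentially by blast
  have step: "pinj_density (Suc n) \<le> q * pinj_density n" if "n \<ge> N" for n
    using N[OF that] assms pinj_density_pos[of "Suc n"] by (simp add: field_simps)
  define C where "C = pinj_density N"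
  have ge: "1 \<le> q ^ n" for n using assms by simp
  have "pinj_density n \<le> C * q ^ n" for n
  proof (induction n)
    case 0
    then show ?case using pinj_density_mono[of 0 N] by (simp add: C_def)
  next
    case (Suc n)
    show ?case
    proof (cases "n \<ge> N")
      case True
      have "pinj_density (Suc n) \<le> q * pinj_density n" by (rule step[OF True])
      also have "\<dots> \<le> q * (C * q ^ n)" using Suc assms by simp
      finally show ?thesis by (simp add: mult_ac)
    next
      case False
      then have "pinj_density (Suc n) \<le> C" using pinj_density_mono[of "Suc n" N] by (simp add: C_def)
      also have "\<dots> \<le> C * q ^ Suc n"
        using ge[of "Suc n"] pinj_density_pos[of N] by (simp add: C_def)
      finally show ?thesis .
    qed
  qed
  then show ?thesis using that[of C] pinj_density_pos by (simp add: C_def)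
qed

section \<open>Cycles of a random partial injection\<close>

text \<open>The directed cycle through the entries of \<open>xs\<close>, closed up from the last entry to the
  first.\<close>

definition cyc :: "'v list \<Rightarrow> ('v \<times> 'v) set" where
  "cyc xs = set (zip xs (rotate1 xs))"

definition has_cycle :: "nat \<Rightarrow> ('v \<times> 'v) set \<Rightarrow> bool" where
  "has_cycle k f \<longleftrightarrow> k > 0 \<and> (\<exists>xs. distinct xs \<and> length xs = k \<and> cyc xs \<subseteq> f)"

lemma Domain_cyc: "Domain (cyc xs) = set xs"
  unfolding cyc_def Domain_fst by (metis length_rotate1 map_fst_zip set_map)

lemma Range_cyc: "Range (cyc xs) = set xs"
  unfolding cyc_def Range_snd by (metis length_rotate1 map_snd_zip set_map set_rotate1)

lemma cyc_in_pinj: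
  assumes "distinct xs"
  shows "cyc xs \<in> pinj (set xs)"
proof (rule pinjI)
  show "cyc xs \<subseteq> set xs \<times> set xs"
    using Domain_cyc[of xs] Range_cyc[of xs] by auto
  have "distinct (map fst (zip xs (rotate1 xs)))" "distinct (map snd (zip xs (rotate1 xs)))"
    using assms by simp_all
  then have inj: "inj_on fst (cyc xs)" "inj_on snd (cyc xs)"
    unfolding cyc_def distinct_map by simp_all
  show "y = y'" if "(x, y) \<in> cyc xs" "(x, y') \<in> cyc xs" for x y y'
    using inj_onD[OF inj(1) _ that] by simp
  show "x = x'" if "(x, y) \<in> cyc xs" "(x', y) \<in> cyc xs" for x x' y
    using inj_onD[OF inj(2) _ that] by simp
qed

lemma cyc_rotate: "cyc (rotate i xs) = cyc xs"
proof -
  have rotate1: "cyc (rotate1 ys) = cyc ys" for ys :: "'a list"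
  proof (cases ys)
    case (Cons y zs)
    show ?thesis
    proof (cases zs)
      case (Cons a l)
      have "zip ((a # l) @ [y]) ((l @ [y]) @ [a]) = zip (a # l) (l @ [y]) @ [(y, a)]"
        by (subst zip_append) auto
      then show ?thesis using \<open>ys = y # zs\<close> Cons by (auto simp: cyc_def)
    qed (use \<open>ys = y # zs\<close> in \<open>simp add: cyc_def\<close>)
  qed simp
  show ?thesis by (induction i) (simp_all add: rotate1)
qed

lemma cyc_nth: "i < length xs \<Longrightarrow> (xs ! i, xs ! (Suc i mod length xs)) \<in> cyc xs"
  unfolding cyc_def by (auto simp: in_set_zip nth_rotate1 intro!: exI[of _ i])

lemma cycles_eq_of_hd_eq:
  assumes func: "\<And>x y y'. (x, y) \<in> f \<Longrightarrow> (x, y') \<in> f \<Longrightarrow> y = y'"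
    and xs: "distinct xs" "xs \<noteq> []" "cyc xs \<subseteq> f"
    and ys: "distinct ys" "ys \<noteq> []" "cyc ys \<subseteq> f"
    and hd: "hd xs = hd ys"
  shows "xs = ys"
proof -
  have agree: "xs ! i = ys ! i" if "i < length xs" "i < length ys" for i
    using that
  proof (induction i)
    case 0
    then show ?case using hd by (simp add: hd_conv_nth)
  next
    case (Suc i)
    then show ?case
      using func[of "xs ! i" "xs ! Suc i" "ys ! Suc i"] cyc_nth[of i xs] cyc_nth[of i ys] xs ys by auto
  qed
  have not_shorter: "\<not> length us < length vs"
    if "distinct vs" "us \<noteq> []" "cyc us \<subseteq> f" "cyc vs \<subseteq> f"
      "\<And>i. i < length us \<Longrightarrow> i < length vs \<Longrightarrow> us ! i = vs ! i" for us vs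
  proof
    assume less: "length us < length vs"
    define m where "m = length us - 1"
    have m: "Suc m = length us" using that(2) by (simp add: m_def)
    have "(us ! m, us ! 0) \<in> f" using cyc_nth[of m us] m that(3) by auto
    moreover have "(vs ! m, vs ! Suc m) \<in> f" using cyc_nth[of m vs] m that(4) less by auto
    ultimately have "vs ! Suc m = us ! 0"
      using func that(5)[of m] m less by (metis Suc_lessD lessI)
    then have "vs ! Suc m = vs ! 0" using that(5)[of 0] that(2) less by fastforce
    then show False using nth_eq_iff_index_eq[of vs "Suc m" 0] that(1) m less by (cases vs) auto
  qed
  have "length xs = length ys"
    using not_shorter[of xs ys] not_shorter[of ys xs] xs ys agree by (metis linorder_neqE_nat)
  then show ?thesis using agree by (intro nth_equalityI) auto
qed

text \<open>Two cycles of the same partial injection that share a vertex coincide, so their lists differ by a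
  rotation. This controls the diagonal terms of the second moment.\<close>

lemma meeting_cycles_rotate:
  assumes func: "\<And>x y y'. (x, y) \<in> f \<Longrightarrow> (x, y') \<in> f \<Longrightarrow> y = y'"
    and xs: "distinct xs" "cyc xs \<subseteq> f"
    and ys: "distinct ys" "cyc ys \<subseteq> f"
    and meet: "set xs \<inter> set ys \<noteq> {}"
  obtains i where "i < length xs" "ys = rotate i xs"
proof -
  obtain i j where i: "i < length xs" and j: "j < length ys" and ij: "xs ! i = ys ! j"
    using meet by (metis disjoint_iff in_set_conv_nth)
  have ne: "xs \<noteq> []" "ys \<noteq> []" using i j by auto
  have "rotate i xs = rotate j ys"
  proof (rule cycles_eq_of_hd_eq[OF func])
    show "hd (rotate i xs) = hd (rotate j ys)"
      using ne i j ij by (simp add: hd_rotate_conv_nth)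
  qed (use xs ys ne in \<open>simp_all add: cyc_rotate\<close>)
  then have "rotate (length ys - j) (rotate i xs) = rotate (length ys - j) (rotate j ys)"
    by simp
  then have "ys = rotate (length ys - j + i) xs"
    using j by (simp add: rotate_rotate)
  then have "ys = rotate ((length ys - j + i) mod length xs) xs"
    by (metis rotate_conv_mod)
  then show ?thesis using that ne by (metis length_greater_0_conv mod_less_divisor)
qed

text \<open>If \<open>c\<close> is a permutation of \<open>U\<close>, then a partial injection containing
  \<open>c\<close> cannot have further pairs that touch \<open>U\<close>, so what remains is an arbitrary
  partial injection of \<open>V - U\<close>.\<close>

lemma card_pinj_containing:
  assumes "c \<in> pinj U" "Domain c = U" "Range c = U" "U \<subseteq> V"
  shows "card {f \<in> pinj V. c \<subseteq> f} = card (pinj (V - U))"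
proof -
  note c = pinjD[OF assms(1)]
  have "bij_betw (\<lambda>g. g \<union> c) (pinj (V - U)) {f \<in> pinj V. c \<subseteq> f}"
  proof (rule bij_betw_byWitness[where f' = "\<lambda>f. f - c"])
    show "\<forall>g\<in>pinj (V - U). g \<union> c - c = g"
      using c(1) by (auto dest!: pinjD(1))
    show "\<forall>f\<in>{f \<in> pinj V. c \<subseteq> f}. f - c \<union> c = f" by auto
    show "(\<lambda>g. g \<union> c) ` pinj (V - U) \<subseteq> {f \<in> pinj V. c \<subseteq> f}"
    proof (rule image_subsetI)
      fix g assume "g \<in> pinj (V - U)"
      note g = pinjD[OF this]
      have "g \<union> c \<in> pinj V"
      proof (rule pinjI)
        show "g \<union> c \<subseteq> V \<times> V" using g(1) c(1) assms(4) by blast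
        show "y = y'" if "(x, y) \<in> g \<union> c" "(x, y') \<in> g \<union> c" for x y y'
          using that g(2) c(2) g(1) c(1) by (elim UnE) auto
        show "x = x'" if "(x, y) \<in> g \<union> c" "(x', y) \<in> g \<union> c" for x x' y
          using that g(3) c(3) g(1) c(1) by (elim UnE) auto
      qed
      then show "g \<union> c \<in> {f \<in> pinj V. c \<subseteq> f}" by simp
    qed
    show "(\<lambda>f. f - c) ` {f \<in> pinj V. c \<subseteq> f} \<subseteq> pinj (V - U)"
    proof (rule image_subsetI)
      fix f assume "f \<in> {f \<in> pinj V. c \<subseteq> f}"
      then have "f \<in> pinj V" and cf: "c \<subseteq> f" by auto
      note f = pinjD[OF this(1)]
      have "x \<notin> U \<and> y \<notin> U" if xy: "(x, y) \<in> f - c" for x y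
      proof (rule ccontr)
        assume "\<not> (x \<notin> U \<and> y \<notin> U)"
        then obtain z where "(x, z) \<in> c \<or> (z, y) \<in> c"
          using assms(2,3) by blast
        then show False using cf xy f(2)[of x y z] f(3)[of x y z] by auto
      qed
      then show "f - c \<in> pinj (V - U)"
        using f by (intro pinjI) auto
    qed
  qed
  then show ?thesis by (simp add: bij_betw_same_card)
qed

text \<open>The possible cycles of length \<open>k\<close>, each listed \<open>k\<close> times, once for every
  starting point.\<close>

definition cycle_lists :: "'v set \<Rightarrow> nat \<Rightarrow> 'v list set" where
  "cycle_lists V k = {xs. length xs = k \<and> distinct xs \<and> set xs \<subseteq> V}"

lemma finite_cycle_lists: "finite V \<Longrightarrow> finite (cycle_lists V k)"
  unfolding cycle_lists_def
  by (rule finite_subset[OF _ finite_lists_length_eq[of V k]]) auto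

lemma card_cycle_lists_eq:
  assumes "finite V" "k \<le> card V"
  shows "real (card (cycle_lists V k)) * real (pinj_count (card V - k)) = fact (card V) * pinj_density (card V - k)"
proof -
  have "card (cycle_lists V k) = \<Prod>{card V - k + 1 .. card V}"
    unfolding cycle_lists_def using assms by (rule card_lists_distinct_length_eq)
  also have "\<dots> = fact (card V) div fact (card V - k)"
    by (simp add: fact_div_fact)
  finally have "real (card (cycle_lists V k)) = fact (card V) / fact (card V - k)"
    by (simp add: real_of_nat_div fact_dvd)
  then show ?thesis by (simp add: pinj_density_def)
qed

lemma pinj_count_eq_density: "real (pinj_count n) = fact n * pinj_density n"
  by (simp add: pinj_density_def)

lemma card_cycle_lists_le:
  assumes "finite V"
  shows "card (cycle_lists V k) * pinj_count (card V - k) \<le> pinj_count (card V)"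
proof (cases "k \<le> card V")
  case True
  have "real (card (cycle_lists V k) * pinj_count (card V - k)) \<le> real (pinj_count (card V))"
    unfolding of_nat_mult card_cycle_lists_eq[OF assms True] pinj_count_eq_density[of "card V"]
    by (intro mult_left_mono pinj_density_mono) auto
  then show ?thesis using of_nat_le_iff by blast
next
  case False
  have "length xs \<le> card V" if "distinct xs" "set xs \<subseteq> V" for xs
    using card_mono[OF assms that(2)] distinct_card[OF that(1)] by simp
  then have "cycle_lists V k = {}"
    using False by (auto simp: cycle_lists_def)
  then show ?thesis by simp
qed

definition cycles_in :: "'v set \<Rightarrow> nat \<Rightarrow> ('v \<times> 'v) set \<Rightarrow> 'v list set" where
  "cycles_in V k f = {xs \<in> cycle_lists V k. cyc xs \<subseteq> f}"

lemma finite_cycles_in: "finite V \<Longrightarrow> finite (cycles_in V k f)"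
  unfolding cycles_in_def by (simp add: finite_cycle_lists)

lemma sum_card_cycles_in:
  assumes "finite V"
  shows "(\<Sum>f\<in>pinj V. card (cycles_in V k f)) = card (cycle_lists V k) * pinj_count (card V - k)"
proof -
  have "\<forall>xs\<in>cycle_lists V k. card {f \<in> pinj V. cyc xs \<subseteq> f} = pinj_count (card V - k)"
  proof
    fix xs assume "xs \<in> cycle_lists V k"
    then have xs: "distinct xs" "set xs \<subseteq> V" "length xs = k" by (auto simp: cycle_lists_def)
    have "card {f \<in> pinj V. cyc xs \<subseteq> f} = card (pinj (V - set xs))"
      using cyc_in_pinj[OF xs(1)] xs(2) by (intro card_pinj_containing) (auto simp: Domain_cyc Range_cyc)
    also have "\<dots> = pinj_count (card V - k)"
      using xs assms by (subst card_pinj) (auto simp: card_Diff_subset distinct_card)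
    finally show "card {f \<in> pinj V. cyc xs \<subseteq> f} = pinj_count (card V - k)" .
  qed
  then have "(\<Sum>f\<in>pinj V. card {xs \<in> cycle_lists V k. cyc xs \<subseteq> f}) = pinj_count (card V - k) * card (cycle_lists V k)"
    by (rule sum_multicount[OF finite_pinj[OF assms] finite_cycle_lists[OF assms]])
  then show ?thesis by (simp add: cycles_in_def mult.commute)
qed

text \<open>Concatenation turns a pair of disjoint cycles into a list of \<open>k + l\<close> distinct
  points, and both cycles are contained in a given proportion of all partial injections that depends only on
  \<open>k + l\<close>.\<close>

lemma sum_card_disjoint_cycles_le:
  assumes "finite V"
  shows "(\<Sum>f\<in>pinj V. card {(xs, ys). xs \<in> cycles_in V k f \<and> ys \<in> cycles_in V l f \<and> set xs \<inter> set ys = {}})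
    \<le> pinj_count (card V)"
proof -
  define P where "P = {(xs, ys). xs \<in> cycle_lists V k \<and> ys \<in> cycle_lists V l \<and> set xs \<inter> set ys = {}}"
  have finP: "finite P"
    by (rule finite_subset[of _ "cycle_lists V k \<times> cycle_lists V l"])
      (use finite_cycle_lists[OF assms] in \<open>auto simp: P_def\<close>)
  have seteq: "{p \<in> P. cyc (fst p) \<union> cyc (snd p) \<subseteq> f} =
      {(xs, ys). xs \<in> cycles_in V k f \<and> ys \<in> cycles_in V l f \<and> set xs \<inter> set ys = {}}" for f
    by (auto simp: P_def cycles_in_def)
  have "\<forall>p\<in>P. card {f \<in> pinj V. cyc (fst p) \<union> cyc (snd p) \<subseteq> f} = pinj_count (card V - (k + l))"
  proof
    fix p assume "p \<in> P"
    then obtain xs ys where p: "p = (xs, ys)" and xs: "distinct xs" "set xs \<subseteq> V" "length xs = k"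
      and ys: "distinct ys" "set ys \<subseteq> V" "length ys = l" and dis: "set xs \<inter> set ys = {}"
      by (auto simp: P_def cycle_lists_def)
    note cx = pinjD[OF cyc_in_pinj[OF xs(1)]] and cy = pinjD[OF cyc_in_pinj[OF ys(1)]]
    have "cyc xs \<union> cyc ys \<in> pinj (set xs \<union> set ys)"
    proof (rule pinjI)
      show "cyc xs \<union> cyc ys \<subseteq> (set xs \<union> set ys) \<times> (set xs \<union> set ys)"
        using cx(1) cy(1) by blast
      show "y = y'" if "(x, y) \<in> cyc xs \<union> cyc ys" "(x, y') \<in> cyc xs \<union> cyc ys" for x y y'
        using that cx(1,2) cy(1,2) dis by (elim UnE) auto
      show "x = x'" if "(x, y) \<in> cyc xs \<union> cyc ys" "(x', y) \<in> cyc xs \<union> cyc ys" for x x' y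
        using that cx(1,3) cy(1,3) dis by (elim UnE) auto
    qed
    then have "card {f \<in> pinj V. cyc xs \<union> cyc ys \<subseteq> f} = card (pinj (V - (set xs \<union> set ys)))"
      using xs(2) ys(2) by (intro card_pinj_containing) (auto simp: Domain_cyc Range_cyc Domain_Un_eq Range_Un_eq)
    also have "\<dots> = pinj_count (card V - (k + l))"
    proof -
      have "card (set xs \<union> set ys) = k + l"
        using xs ys dis by (simp add: card_Un_disjoint distinct_card)
      then show ?thesis using xs(2) ys(2) assms by (subst card_pinj) (auto simp: card_Diff_subset)
    qed
    finally show "card {f \<in> pinj V. cyc (fst p) \<union> cyc (snd p) \<subseteq> f} = pinj_count (card V - (k + l))"
      by (simp add: p)
  qed
  then have "(\<Sum>f\<in>pinj V. card {p \<in> P. cyc (fst p) \<union> cyc (snd p) \<subseteq> f}) = pinj_count (card V - (k + l)) * card P"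
    by (rule sum_multicount[OF finite_pinj[OF assms] finP])
  also have "\<dots> \<le> pinj_count (card V - (k + l)) * card (cycle_lists V (k + l))"
  proof -
    have "inj_on (\<lambda>(xs, ys). xs @ ys) P"
      by (auto simp: inj_on_def P_def cycle_lists_def)
    moreover have "(\<lambda>(xs, ys). xs @ ys) ` P \<subseteq> cycle_lists V (k + l)"
      by (auto simp: P_def cycle_lists_def)
    ultimately show ?thesis
      using finite_cycle_lists[OF assms] by (intro mult_left_mono card_inj_on_le) auto
  qed
  also have "\<dots> \<le> pinj_count (card V)"
    using card_cycle_lists_le[OF assms] by (simp add: mult.commute)
  finally show ?thesis unfolding seteq .
qed

lemma card_meeting_cycles_le:
  assumes "finite V" "f \<in> pinj V"
  shows "card {(xs, ys). xs \<in> cycles_in V k f \<and> ys \<in> cycles_in V l f \<and> set xs \<inter> set ys \<noteq> {}}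
    \<le> (if k = l then k * card (cycles_in V k f) else 0)"
proof -
  let ?M = "{(xs, ys). xs \<in> cycles_in V k f \<and> ys \<in> cycles_in V l f \<and> set xs \<inter> set ys \<noteq> {}}"
  have rot: "\<exists>i<k. ys = rotate i xs" if "(xs, ys) \<in> ?M" for xs ys
    using that meeting_cycles_rotate[of f xs ys] pinjD(2)[OF assms(2)]
    by (auto simp: cycles_in_def cycle_lists_def)
  show ?thesis
  proof (cases "k = l")
    case False
    have "?M = {}"
    proof (rule ccontr)
      assume "?M \<noteq> {}"
      then obtain xs ys where m: "(xs, ys) \<in> ?M" by auto
      then have "length xs = length ys" using rot by fastforce
      then show False using m False by (auto simp: cycles_in_def cycle_lists_def)
    qed
    then show ?thesis by (metis card.empty le0)
  next
    case True
    have "?M \<subseteq> (\<lambda>(xs, i). (xs, rotate i xs)) ` (cycles_in V k f \<times> {..<k})"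
      using rot by fastforce
    then have "card ?M \<le> card ((\<lambda>(xs, i). (xs, rotate i xs)) ` (cycles_in V k f \<times> {..<k}))"
      using finite_cycles_in[OF assms(1)] by (intro card_mono) auto
    also have "\<dots> \<le> card (cycles_in V k f \<times> {..<k})"
      using finite_cycles_in[OF assms(1)] by (intro card_image_le) auto
    finally show ?thesis using True by (simp add: card_cartesian_product mult.commute)
  qed
qed

text \<open>Dividing by \<open>k\<close> compensates for the \<open>k\<close> starting points: this is the
  number of cycles of \<open>f\<close> whose length lies in \<open>S\<close>.\<close>

definition cycle_number :: "nat set \<Rightarrow> 'v set \<Rightarrow> ('v \<times> 'v) set \<Rightarrow> real" where
  "cycle_number S V f = (\<Sum>k\<in>S. card (cycles_in V k f) / k)"

text \<open>As the ratio of densities tends to \<open>1\<close>, the expected number of cycles of length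
  \<open>k\<close> tends to \<open>1 / k\<close>.\<close>

lemma sum_cycle_number:
  assumes "finite V" "\<And>k. k \<in> S \<Longrightarrow> k \<le> card V"
  shows "(\<Sum>f\<in>pinj V. cycle_number S V f)
    = pinj_count (card V) * (\<Sum>k\<in>S. pinj_density (card V - k) / pinj_density (card V) / k)"
proof -
  have "(\<Sum>f\<in>pinj V. cycle_number S V f) = (\<Sum>k\<in>S. \<Sum>f\<in>pinj V. card (cycles_in V k f) / k)"
    unfolding cycle_number_def by (rule sum.swap)
  also have "\<dots> = (\<Sum>k\<in>S. fact (card V) * pinj_density (card V - k) / k)"
  proof (rule sum.cong)
    fix k assume "k \<in> S"
    have "(\<Sum>f\<in>pinj V. card (cycles_in V k f) / k) = real (\<Sum>f\<in>pinj V. card (cycles_in V k f)) / k"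
      by (simp add: sum_divide_distrib)
    then show "(\<Sum>f\<in>pinj V. card (cycles_in V k f) / k) = fact (card V) * pinj_density (card V - k) / k"
      using card_cycle_lists_eq[OF assms(1) assms(2)[OF \<open>k \<in> S\<close>]]
      by (simp add: sum_card_cycles_in[OF assms(1)])
  qed simp
  also have "\<dots> = (\<Sum>k\<in>S. pinj_count (card V) * (pinj_density (card V - k) / pinj_density (card V) / k))"
    using pinj_density_pos[of "card V"] by (simp add: pinj_count_eq_density)
  finally show ?thesis by (simp add: sum_distrib_left)
qed

text \<open>Ordered pairs of cycles are either disjoint, which contributes at most the product of the limiting
  means, or equal, which contributes at most the mean itself.\<close>

lemma sum_cycle_number_square:
  assumes "finite V" "finite S" "0 \<notin> S"
  shows "(\<Sum>f\<in>pinj V. (cycle_number S V f)\<^sup>2) \<le> pinj_count (card V) * ((\<Sum>k\<in>S. 1 / k)\<^sup>2 + (\<Sum>k\<in>S. 1 / k))"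
proof -
  let ?I = "real (pinj_count (card V))"
  have pairs: "(\<Sum>f\<in>pinj V. real (card (cycles_in V k f)) * card (cycles_in V l f))
      \<le> ?I + (if k = l then k * ?I else 0)" for k l
  proof -
    have "card (cycles_in V k f) * card (cycles_in V l f)
        \<le> card {(xs, ys). xs \<in> cycles_in V k f \<and> ys \<in> cycles_in V l f \<and> set xs \<inter> set ys = {}}
          + (if k = l then k * card (cycles_in V k f) else 0)" (is "_ \<le> card ?D + _") if "f \<in> pinj V" for f
    proof -
      let ?M = "{(xs, ys). xs \<in> cycles_in V k f \<and> ys \<in> cycles_in V l f \<and> set xs \<inter> set ys \<noteq> {}}"
      have "cycles_in V k f \<times> cycles_in V l f = ?D \<union> ?M" by auto
      then have "card (cycles_in V k f) * card (cycles_in V l f) \<le> card ?D + card ?M"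
        using card_Un_le[of ?D ?M] by (metis card_cartesian_product)
      then show ?thesis using card_meeting_cycles_le[OF assms(1) that, of k l] by linarith
    qed
    then have "(\<Sum>f\<in>pinj V. card (cycles_in V k f) * card (cycles_in V l f))
        \<le> (\<Sum>f\<in>pinj V. card {(xs, ys). xs \<in> cycles_in V k f \<and> ys \<in> cycles_in V l f \<and> set xs \<inter> set ys = {}}
          + (if k = l then k * card (cycles_in V k f) else 0))"
      by (rule sum_mono)
    also have "\<dots> \<le> pinj_count (card V) + (if k = l then k * (\<Sum>f\<in>pinj V. card (cycles_in V k f)) else 0)"
      using sum_card_disjoint_cycles_le[OF assms(1), of k l]
      by (cases "k = l") (simp_all add: sum.distrib sum_distrib_left)
    also have "\<dots> \<le> pinj_count (card V) + (if k = l then k * pinj_count (card V) else 0)"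
      using card_cycle_lists_le[OF assms(1), of k]
      by (cases "k = l") (simp_all add: sum_card_cycles_in[OF assms(1)])
    finally have "real (\<Sum>f\<in>pinj V. card (cycles_in V k f) * card (cycles_in V l f))
        \<le> real (pinj_count (card V) + (if k = l then k * pinj_count (card V) else 0))"
      by (rule of_nat_mono)
    then show ?thesis by (simp split: if_splits)
  qed
  have "(\<Sum>f\<in>pinj V. (cycle_number S V f)\<^sup>2)
      = (\<Sum>f\<in>pinj V. \<Sum>k\<in>S. \<Sum>l\<in>S. real (card (cycles_in V k f)) * card (cycles_in V l f) / (real k * l))"
    unfolding cycle_number_def power2_eq_square sum_product by simp
  also have "\<dots> = (\<Sum>k\<in>S. \<Sum>l\<in>S. (\<Sum>f\<in>pinj V. real (card (cycles_in V k f)) * card (cycles_in V l f)) / (real k * l))"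
    by (subst sum.swap, rule sum.cong, simp, subst sum.swap) (simp add: sum_divide_distrib)
  also have "\<dots> \<le> (\<Sum>k\<in>S. \<Sum>l\<in>S. (?I + (if k = l then k * ?I else 0)) / (real k * l))"
    using pairs by (intro sum_mono divide_right_mono) auto
  also have "\<dots> = (\<Sum>k\<in>S. \<Sum>l\<in>S. ?I * (1 / k * (1 / l)) + (if k = l then ?I * (1 / k) else 0))"
  proof (intro sum.cong refl)
    fix k l assume "k \<in> S" "l \<in> S"
    then have "k \<noteq> 0" "l \<noteq> 0" using assms(3) by metis+
    then show "(?I + (if k = l then k * ?I else 0)) / (real k * l)
        = ?I * (1 / k * (1 / l)) + (if k = l then ?I * (1 / k) else 0)"
      by (simp add: field_simps)
  qed
  also have "\<dots> = (\<Sum>k\<in>S. \<Sum>l\<in>S. ?I * (1 / k * (1 / l))) + ?I * (\<Sum>k\<in>S. 1 / k)"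
    using assms(2) by (simp add: sum.distrib sum.delta' sum_distrib_left)
  also have "(\<Sum>k\<in>S. \<Sum>l\<in>S. ?I * (1 / k * (1 / l))) = ?I * ((\<Sum>k\<in>S. 1 / k) * (\<Sum>k\<in>S. 1 / k))"
    by (subst sum_product) (simp only: sum_distrib_left)
  finally show ?thesis by (simp add: power2_eq_square distrib_left)
qed

text \<open>Chebyshev: the number of cycles with length in \<open>S\<close> has mean and variance close to
  \<open>\<mu> = (\<Sum>k\<in>S. 1 / k)\<close>, so it vanishes with probability at most about
  \<open>1 / \<mu>\<close>. The constant \<open>2\<close> leaves room for the convergence.\<close>

lemma card_no_cycle_le:
  assumes "finite S" "0 \<notin> S" "S \<noteq> {}"
  shows "eventually (\<lambda>n. card {f \<in> pinj {..<n}. \<forall>k\<in>S. \<not> has_cycle k f}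
      \<le> 2 / (\<Sum>k\<in>S. 1 / k) * pinj_count n) sequentially"
proof -
  define \<mu> where "\<mu> = (\<Sum>k\<in>S. 1 / real k)"
  have "\<mu> > 0"
    unfolding \<mu>_def using assms by (intro sum_pos) (auto intro!: Nat.gr0I)
  define e where "e n = (\<Sum>k\<in>S. pinj_density (n - k) / pinj_density n / k)" for n
  have "e \<longlonglongrightarrow> (\<Sum>k\<in>S. 1 / k)"
    unfolding e_def
  proof (intro tendsto_intros)
    fix k assume "k \<in> S"
    then show "real k \<noteq> 0" using assms(2) by (metis of_nat_eq_0_iff)
    have "(\<lambda>n. pinj_density (n + k - k) / pinj_density (n + k)) \<longlonglongrightarrow> 1"
      using pinj_density_ratio by simp
    then show "(\<lambda>n. pinj_density (n - k) / pinj_density n) \<longlonglongrightarrow> 1"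
      by (rule LIMSEQ_offset)
  qed
  then have "eventually (\<lambda>n. e n > \<mu> - 1 / 2) sequentially"
    unfolding \<mu>_def[symmetric] by (rule order_tendstoD) simp
  moreover have "eventually (\<lambda>n. n \<ge> Max S) sequentially"
    by (rule eventually_ge_at_top)
  ultimately show ?thesis
  proof eventually_elim
    case (elim n)
    let ?V = "{..<n}" and ?I = "real (pinj_count n)"
    let ?B = "{f \<in> pinj ?V. \<forall>k\<in>S. \<not> has_cycle k f}"
    have B0: "cycle_number S ?V f = 0" if "f \<in> ?B" for f
    proof -
      have "cycles_in ?V k f = {}" if "k \<in> S" for k
        using that \<open>f \<in> ?B\<close> assms(2) by (auto simp: has_cycle_def cycles_in_def cycle_lists_def intro!: Nat.gr0I)
      then show ?thesis by (simp add: cycle_number_def)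
    qed
    have "card ?B * \<mu>\<^sup>2 = (\<Sum>f\<in>?B. (cycle_number S ?V f - \<mu>)\<^sup>2)"
      by (simp add: B0)
    also have "\<dots> \<le> (\<Sum>f\<in>pinj ?V. (cycle_number S ?V f - \<mu>)\<^sup>2)"
      by (intro sum_mono2 finite_pinj) auto
    also have "\<dots> = (\<Sum>f\<in>pinj ?V. (cycle_number S ?V f)\<^sup>2) - 2 * \<mu> * (\<Sum>f\<in>pinj ?V. cycle_number S ?V f) + ?I * \<mu>\<^sup>2"
      by (simp add: power2_diff sum.distrib sum_subtractf sum_distrib_left sum_distrib_right pinj_count_def mult_ac)
    also have "\<dots> \<le> ?I * (\<mu>\<^sup>2 + \<mu>) - 2 * \<mu> * (?I * e n) + ?I * \<mu>\<^sup>2"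
      using sum_cycle_number_square[of ?V S] sum_cycle_number[of ?V S] assms elim(2)
      by (simp add: \<mu>_def e_def)
    also have "\<dots> \<le> ?I * (\<mu>\<^sup>2 + \<mu>) - 2 * \<mu> * (?I * (\<mu> - 1 / 2)) + ?I * \<mu>\<^sup>2"
      using elim(1) \<open>\<mu> > 0\<close> by (intro add_right_mono diff_left_mono mult_left_mono) auto
    also have "\<dots> = 2 * \<mu> * ?I" by (simp add: algebra_simps power2_eq_square)
    finally have "card ?B * \<mu> \<le> 2 * ?I"
      using \<open>\<mu> > 0\<close> by (simp add: power2_eq_square)
    then show ?case
      using \<open>\<mu> > 0\<close> unfolding \<mu>_def[symmetric] by (simp add: field_simps)
  qed
qed

definition coprime_cycles :: "('v \<times> 'v) set \<Rightarrow> bool" where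
  "coprime_cycles f \<longleftrightarrow> (\<exists>k l. coprime k l \<and> has_cycle k f \<and> has_cycle l f)"

text \<open>Compare \<open>d * m + 1\<close> with \<open>(d + 1) * m\<close>.\<close>

lemma harmonic_progression_unbounded:
  assumes "d > 0"
  obtains M where "M > 0" "C \<le> (\<Sum>k\<in>(\<lambda>m. d * m + 1) ` {1..M}. 1 / real k)"
proof -
  have "eventually (\<lambda>M. C * (d + 1) \<le> harm M) sequentially"
    using harm_at_top by (simp add: filterlim_at_top)
  then have "eventually (\<lambda>M. C * (d + 1) \<le> harm M \<and> M > 0) sequentially"
    using eventually_gt_at_top[of 0] by (rule eventually_conj)
  then obtain M where M: "C * (d + 1) \<le> harm M" "M > 0"
    unfolding eventually_sequentially by blast
  have "C \<le> harm M / (d + 1)" using M(1) by (simp add: field_simps)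
  also have "\<dots> = (\<Sum>m\<in>{1..M}. 1 / (real (d + 1) * m))"
    by (simp add: harm_def sum_divide_distrib divide_simps mult.commute)
  also have "\<dots> \<le> (\<Sum>m\<in>{1..M}. 1 / real (d * m + 1))"
    by (intro sum_mono frac_le) (auto simp: algebra_simps add_pos_nonneg)
  also have "\<dots> = (\<Sum>k\<in>(\<lambda>m. d * m + 1) ` {1..M}. 1 / real k)"
    using assms by (subst sum.reindex) (auto simp: inj_on_def)
  finally show ?thesis using that M(2) by blast
qed

text \<open>Look for one cycle with length in an initial segment \<open>S\<close> and one with length in a
  progression \<open>T\<close> of numbers congruent to \<open>1\<close> modulo a common multiple of
  \<open>S\<close>. Any two such lengths are coprime, and both \<open>S\<close> and \<open>T\<close> can be
  chosen with large harmonic sums.\<close>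

lemma card_not_coprime_cycles:
  fixes \<epsilon> :: real
  assumes "\<epsilon> > 0"
  shows "eventually (\<lambda>n. card {f \<in> pinj {..<n}. \<not> coprime_cycles f} \<le> \<epsilon> * pinj_count n) sequentially"
proof -
  \<comment> \<open>With harmonic sum at least \<open>4 / \<epsilon>\<close>, the bound \<open>2 / \<mu>\<close> is at most \<open>\<epsilon> / 2\<close> for each
      of the two sets. The progression with \<open>d = 1\<close> is \<open>{2..K + 1}\<close>.\<close>
  obtain K where K: "K > 0" "4 / \<epsilon> \<le> (\<Sum>k\<in>(\<lambda>m. 1 * m + 1) ` {1..K}. 1 / real k)"
    using harmonic_progression_unbounded[of 1 "4 / \<epsilon>"] by auto
  define S where "S = (\<lambda>m. 1 * m + 1) ` {1..K}"
  \<comment> \<open>A common multiple of \<open>S\<close>, so that \<open>d * m + 1\<close> is coprime to every element of \<open>S\<close>.\<close>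
  define d where "d = (\<Prod>k\<in>S. k)"
  have d: "d > 0" "\<And>k. k \<in> S \<Longrightarrow> k dvd d"
  proof -
    show "d > 0" unfolding d_def by (intro prod_pos) (auto simp: S_def)
    show "k dvd d" if "k \<in> S" for k
      unfolding d_def using dvd_prodI[of S k "\<lambda>k. k"] that by (simp add: S_def)
  qed
  obtain M where M: "M > 0" "4 / \<epsilon> \<le> (\<Sum>k\<in>(\<lambda>m. d * m + 1) ` {1..M}. 1 / real k)"
    using harmonic_progression_unbounded[OF d(1), of "4 / \<epsilon>"] by blast
  define T where "T = (\<lambda>m. d * m + 1) ` {1..M}"
  have coprime: "coprime k l" if kS: "k \<in> S" and lT: "l \<in> T" for k l
  proof -
    obtain m where l: "l = d * m + 1" using lT by (auto simp: T_def)
    have "coprime (d * m) l" unfolding l by (simp add: coprime_Suc_right_nat)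
    then show ?thesis using d(2)[OF kS] by (meson coprime_divisors dvd_mult2 dvd_refl)
  qed
  have half: "2 / s \<le> \<epsilon> / 2" if "4 / \<epsilon> \<le> s" for s
  proof -
    have "s > 0" using assms that by (smt (verit) divide_pos_pos)
    then show ?thesis using assms that by (simp add: field_simps)
  qed
  have "eventually (\<lambda>n. card {f \<in> pinj {..<n}. \<forall>k\<in>S. \<not> has_cycle k f} \<le> 2 / (\<Sum>k\<in>S. 1 / k) * pinj_count n) sequentially"
    by (rule card_no_cycle_le) (use K(1) in \<open>auto simp: S_def\<close>)
  moreover have "eventually (\<lambda>n. card {f \<in> pinj {..<n}. \<forall>k\<in>T. \<not> has_cycle k f} \<le> 2 / (\<Sum>k\<in>T. 1 / k) * pinj_count n) sequentially"
    by (rule card_no_cycle_le) (use M(1) in \<open>auto simp: T_def\<close>)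
  ultimately show ?thesis
  proof eventually_elim
    case (elim n)
    let ?B = "\<lambda>S. {f \<in> pinj {..<n}. \<forall>k\<in>S. \<not> has_cycle k f}"
    have "card {f \<in> pinj {..<n}. \<not> coprime_cycles f} \<le> card (?B S \<union> ?B T)"
      using coprime by (intro card_mono) (auto simp: finite_pinj coprime_cycles_def)
    also have "\<dots> \<le> card (?B S) + card (?B T)" by (rule card_Un_le)
    finally have "real (card {f \<in> pinj {..<n}. \<not> coprime_cycles f}) \<le> real (card (?B S)) + real (card (?B T))"
      by linarith
    also have "\<dots> \<le> \<epsilon> / 2 * pinj_count n + \<epsilon> / 2 * pinj_count n"
    proof (rule add_mono)
      show "real (card (?B S)) \<le> \<epsilon> / 2 * pinj_count n"
        using elim(1) mult_right_mono[OF half[OF K(2)], of "real (pinj_count n)"] unfolding S_def by linarith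
      show "real (card (?B T)) \<le> \<epsilon> / 2 * pinj_count n"
        using elim(2) mult_right_mono[OF half[OF M(2)], of "real (pinj_count n)"] unfolding T_def by linarith
    qed
    finally show ?case by simp
  qed
qed

section \<open>Random labelled graphs\<close>

definition label_edges :: "('v \<times> 'a \<times> 'v) set \<Rightarrow> 'a \<Rightarrow> ('v \<times> 'v) set" where
  "label_edges E a = {(x, y). (x, a, y) \<in> E}"

lemma in_label_edges [simp]: "(x, y) \<in> label_edges E a \<longleftrightarrow> (x, a, y) \<in> E"
  by (simp add: label_edges_def)

lemma A_graph_iff_label_edges:
  "A_graph A V E \<longleftrightarrow> E \<subseteq> UNIV \<times> A \<times> UNIV \<and> (\<forall>a\<in>A. label_edges E a \<in> pinj V)"
  unfolding A_graph_def pinj_iff by (auto simp: label_edges_def) blast+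

lemma graph_of_label_edges:
  fixes E :: "('v \<times> 'a \<times> 'v) set"
  assumes "E \<subseteq> UNIV \<times> A \<times> UNIV"
  shows "{(x, a, y). a \<in> A \<and> (x, y) \<in> restrict (label_edges E) A a} = E"
proof (rule Set.set_eqI)
  fix p :: "'v \<times> 'a \<times> 'v"
  obtain x a y where p: "p = (x, a, y)" by (rule prod_cases3)
  have "p \<in> E \<Longrightarrow> a \<in> A" using assms p by blast
  then show "p \<in> {(x, a, y). a \<in> A \<and> (x, y) \<in> restrict (label_edges E) A a} \<longleftrightarrow> p \<in> E"
    unfolding p by (cases "a \<in> A") auto
qed

text \<open>Graphs correspond to tuples of partial injections indexed by \<open>A\<close>, so conditions on
  the single labels are independent.\<close>

lemma card_A_graphs:
  assumes "finite A" "\<And>a. a \<in> A \<Longrightarrow> B a \<subseteq> pinj V"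
  shows "card {E. A_graph A V E \<and> (\<forall>a\<in>A. label_edges E a \<in> B a)} = (\<Prod>a\<in>A. card (B a))"
proof -
  have "bij_betw (\<lambda>E. restrict (label_edges E) A)
      {E. A_graph A V E \<and> (\<forall>a\<in>A. label_edges E a \<in> B a)} (PiE A B)"
  proof (rule bij_betw_byWitness[where f' = "\<lambda>F. {(x, a, y). a \<in> A \<and> (x, y) \<in> F a}"])
    show "\<forall>E\<in>{E. A_graph A V E \<and> (\<forall>a\<in>A. label_edges E a \<in> B a)}.
        {(x, a, y). a \<in> A \<and> (x, y) \<in> restrict (label_edges E) A a} = E"
      using graph_of_label_edges by (auto simp: A_graph_iff_label_edges)
    have label: "label_edges {(x, a, y). a \<in> A \<and> (x, y) \<in> F a} a = F a" if "a \<in> A" for F a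
      using that by (auto simp: label_edges_def)
    show "\<forall>F\<in>PiE A B. restrict (label_edges {(x, a, y). a \<in> A \<and> (x, y) \<in> F a}) A = F"
    proof
      fix F assume F: "F \<in> PiE A B"
      have "restrict (label_edges {(x, a, y). a \<in> A \<and> (x, y) \<in> F a}) A b = F b" for b
        by (cases "b \<in> A") (simp_all add: label PiE_arb[OF F])
      then show "restrict (label_edges {(x, a, y). a \<in> A \<and> (x, y) \<in> F a}) A = F" by (rule ext)
    qed
    show "(\<lambda>F. {(x, a, y). a \<in> A \<and> (x, y) \<in> F a}) ` PiE A B
        \<subseteq> {E. A_graph A V E \<and> (\<forall>a\<in>A. label_edges E a \<in> B a)}"
    proof (rule image_subsetI)
      fix F assume "F \<in> PiE A B"
      then have "\<forall>a\<in>A. F a \<in> B a" by auto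
      then show "{(x, a, y). a \<in> A \<and> (x, y) \<in> F a} \<in> {E. A_graph A V E \<and> (\<forall>a\<in>A. label_edges E a \<in> B a)}"
        using assms(2) by (auto simp: A_graph_iff_label_edges label)
    qed
  qed auto
  then show ?thesis
    using assms(1) by (simp add: bij_betw_same_card card_PiE)
qed

lemma finite_A_graphs:
  assumes "finite A" "finite V"
  shows "finite {E. A_graph A V E}"
  by (rule finite_subset[of _ "Pow (V \<times> A \<times> V)"]) (use assms in \<open>auto simp: A_graph_def\<close>)

lemma card_all_A_graphs:
  assumes "finite A" "finite V"
  shows "card {E. A_graph A V E} = pinj_count (card V) ^ card A"
proof -
  have "{E. A_graph A V E} = {E. A_graph A V E \<and> (\<forall>a\<in>A. label_edges E a \<in> pinj V)}"
    by (auto simp: A_graph_iff_label_edges)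
  then show ?thesis
    using card_A_graphs[OF assms(1), of "\<lambda>_. pinj V" V] by (simp add: card_pinj[OF assms(2)])
qed

lemma card_A_graphs_bad_label_le:
  assumes "finite A" "finite V"
  shows "card {E. A_graph A V E \<and> (\<exists>a\<in>A. \<not> P (label_edges E a))}
    \<le> card A * (card {f \<in> pinj V. \<not> P f} * pinj_count (card V) ^ (card A - 1))"
proof -
  have "{E. A_graph A V E \<and> (\<exists>a\<in>A. \<not> P (label_edges E a))}
      \<subseteq> (\<Union>a\<in>A. {E. A_graph A V E \<and> (\<forall>b\<in>A. label_edges E b \<in> (if b = a then {f \<in> pinj V. \<not> P f} else pinj V))})"
  proof clarify
    fix E a assume E: "A_graph A V E" "a \<in> A" "\<not> P (label_edges E a)"
    then have "\<forall>b\<in>A. label_edges E b \<in> (if b = a then {f \<in> pinj V. \<not> P f} else pinj V)"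
      by (simp add: A_graph_iff_label_edges)
    with E(1,2) show "E \<in> (\<Union>a\<in>A. {E. A_graph A V E \<and> (\<forall>b\<in>A. label_edges E b \<in> (if b = a then {f \<in> pinj V. \<not> P f} else pinj V))})"
      by blast
  qed
  then have "card {E. A_graph A V E \<and> (\<exists>a\<in>A. \<not> P (label_edges E a))}
      \<le> card (\<Union>a\<in>A. {E. A_graph A V E \<and> (\<forall>b\<in>A. label_edges E b \<in> (if b = a then {f \<in> pinj V. \<not> P f} else pinj V))})"
    using finite_A_graphs[OF assms] assms(1) by (intro card_mono) auto
  also have "\<dots> \<le> (\<Sum>a\<in>A. card {E. A_graph A V E \<and> (\<forall>b\<in>A. label_edges E b \<in> (if b = a then {f \<in> pinj V. \<not> P f} else pinj V))})"
    by (rule card_UN_le[OF assms(1)])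
  also have "\<dots> = (\<Sum>a\<in>A. card {f \<in> pinj V. \<not> P f} * pinj_count (card V) ^ (card A - 1))"
  proof (rule sum.cong)
    fix a assume "a \<in> A"
    have "card {E. A_graph A V E \<and> (\<forall>b\<in>A. label_edges E b \<in> (if b = a then {f \<in> pinj V. \<not> P f} else pinj V))}
        = (\<Prod>b\<in>A. card (if b = a then {f \<in> pinj V. \<not> P f} else pinj V))"
      by (rule card_A_graphs[OF assms(1)]) auto
    also have "\<dots> = card {f \<in> pinj V. \<not> P f} * (\<Prod>b\<in>A - {a}. card (pinj V))"
      using assms(1) \<open>a \<in> A\<close> by (simp add: prod.remove[of A a])
    also have "\<dots> = card {f \<in> pinj V. \<not> P f} * pinj_count (card V) ^ (card A - 1)"
      using \<open>a \<in> A\<close> assms by (simp add: card_pinj card_Diff_singleton)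
    finally show "card {E. A_graph A V E \<and> (\<forall>b\<in>A. label_edges E b \<in> (if b = a then {f \<in> pinj V. \<not> P f} else pinj V))}
        = card {f \<in> pinj V. \<not> P f} * pinj_count (card V) ^ (card A - 1)" .
  qed simp
  finally show ?thesis by simp
qed

text \<open>A leaf meets at most one edge end: all labels but one avoid it, and the remaining label does not
  both enter and leave it.\<close>

lemma leaf_labels:
  assumes "finite A" "A \<noteq> {}" "finite V" "A_graph A V E" "leaf E v"
  obtains a where "a \<in> A" "v \<notin> Range (label_edges E a) \<or> v \<notin> Domain (label_edges E a)"
    "\<And>b. b \<in> A - {a} \<Longrightarrow> label_edges E b \<in> pinj (V - {v})"
proof -
  let ?out = "{(x, a, y) \<in> E. x = v}" and ?in = "{(x, a, y) \<in> E. y = v}"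
  have EA: "E \<subseteq> V \<times> A \<times> V" using assms(4) by (simp add: A_graph_def)
  then have "finite E" using assms(1,3) by (meson finite_SigmaI finite_subset)
  then have fin: "finite ?out" "finite ?in" by (auto intro: finite_subset[of _ E])
  have le1: "card ?out + card ?in \<le> 1"
    using assms(5) by (simp add: leaf_def occurrences_def)
  then have "card ?out = 0 \<or> card ?in = 0" by linarith
  then have empty: "?out = {} \<or> ?in = {}" using fin by simp
  have "card (?out \<union> ?in) \<le> Suc 0" using le1 card_Un_le[of ?out ?in] by linarith
  then have uniq: "\<forall>p\<in>?out \<union> ?in. \<forall>q\<in>?out \<union> ?in. p = q"
    using card_le_Suc0_iff_eq[of "?out \<union> ?in"] fin by (simp only: finite_Un)
  obtain a where a: "a \<in> A" "\<And>x b y. (x, b, y) \<in> ?out \<union> ?in \<Longrightarrow> b = a"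
  proof (cases "?out \<union> ?in = {}")
    case True
    obtain a where "a \<in> A" using assms(2) by blast
    then show ?thesis using that[of a] True by blast
  next
    case False
    then obtain x0 a0 y0 where p: "(x0, a0, y0) \<in> ?out \<union> ?in" by blast
    then have "a0 \<in> A" using EA by auto
    moreover have "b = a0" if "(x, b, y) \<in> ?out \<union> ?in" for x b y
      using uniq[rule_format, OF p that] by simp
    ultimately show ?thesis using that by blast
  qed
  have "v \<notin> Range (label_edges E a) \<or> v \<notin> Domain (label_edges E a)"
    using empty by (auto simp: label_edges_def)
  moreover have "label_edges E b \<in> pinj (V - {v})" if "b \<in> A - {a}" for b
  proof -
    have "label_edges E b \<in> pinj V" using assms(4) that by (simp add: A_graph_iff_label_edges)
    moreover have "x \<noteq> v \<and> y \<noteq> v" if "(x, y) \<in> label_edges E b" for x y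
      using that \<open>b \<in> A - {a}\<close> a(2)[of x b y] by auto
    then have "label_edges E b \<subseteq> (V - {v}) \<times> (V - {v})"
      using EA by (auto simp: label_edges_def)
    ultimately show ?thesis by (rule pinj_restrict)
  qed
  ultimately show ?thesis using that a(1) by blast
qed

text \<open>By insertion, a fixed vertex is isolated for one label with probability at most
  \<open>1 / n\<close>, and the expected number of vertices without an incoming or without an outgoing edge
  of another label is at most \<open>2 * sqrt n\<close>. Two different labels are required here, so the
  expected number of leaves is at most of order \<open>1 / sqrt n\<close>.\<close>

lemma card_leaf_graphs_le:
  assumes "finite A" "card A \<ge> 2" "finite V" "card V > 0"
  shows "card {E. A_graph A V E \<and> (\<exists>v\<in>V. leaf E v)}
    \<le> 2 * card A / sqrt (card V) * pinj_count (card V) ^ card A"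
proof -
  let ?n = "card V" and ?r = "card A"
  let ?I = "real (pinj_count ?n)"
  define D where "D v = {f \<in> pinj V. v \<notin> Range f \<or> v \<notin> Domain f}" for v
  define G where "G v a = {E. A_graph A V E \<and> (\<forall>b\<in>A. label_edges E b \<in> (if b = a then D v else pinj (V - {v})))}" for v a
  have "A \<noteq> {}" using assms(2) by auto
  have "{E. A_graph A V E \<and> (\<exists>v\<in>V. leaf E v)} \<subseteq> (\<Union>v\<in>V. \<Union>a\<in>A. G v a)"
  proof clarify
    fix E v assume E: "A_graph A V E" "v \<in> V" "leaf E v"
    obtain a where "a \<in> A" "v \<notin> Range (label_edges E a) \<or> v \<notin> Domain (label_edges E a)"
      "\<And>b. b \<in> A - {a} \<Longrightarrow> label_edges E b \<in> pinj (V - {v})"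
      using leaf_labels[OF assms(1) \<open>A \<noteq> {}\<close> assms(3) E(1,3)] by blast
    then have "E \<in> G v a"
      using E(1) by (auto simp: G_def D_def A_graph_iff_label_edges)
    then show "E \<in> (\<Union>v\<in>V. \<Union>a\<in>A. G v a)" using \<open>a \<in> A\<close> E(2) by blast
  qed
  then have "card {E. A_graph A V E \<and> (\<exists>v\<in>V. leaf E v)} \<le> card (\<Union>v\<in>V. \<Union>a\<in>A. G v a)"
    using assms(1,3) finite_A_graphs[OF assms(1,3)] by (intro card_mono) (auto simp: G_def)
  also have "\<dots> \<le> (\<Sum>v\<in>V. card (\<Union>a\<in>A. G v a))"
    by (rule card_UN_le[OF assms(3)])
  also have "\<dots> \<le> (\<Sum>v\<in>V. \<Sum>a\<in>A. card (G v a))"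
    by (intro sum_mono card_UN_le[OF assms(1)])
  also have "\<dots> = (\<Sum>v\<in>V. ?r * (card (D v) * pinj_count (?n - 1) ^ (?r - 1)))"
  proof (rule sum.cong)
    fix v assume v: "v \<in> V"
    have "card (G v a) = card (D v) * pinj_count (?n - 1) ^ (?r - 1)" if "a \<in> A" for a
    proof -
      have "card (G v a) = (\<Prod>b\<in>A. card (if b = a then D v else pinj (V - {v})))"
        unfolding G_def
      proof (rule card_A_graphs[OF assms(1)])
        show "(if b = a then D v else pinj (V - {v})) \<subseteq> pinj V" for b
          unfolding D_def using pinj_mono[of "V - {v}" V] by auto
      qed
      also have "\<dots> = card (D v) * (\<Prod>b\<in>A - {a}. card (pinj (V - {v})))"
        using assms(1) that by (simp add: prod.remove[of A a])
      also have "\<dots> = card (D v) * pinj_count (?n - 1) ^ (?r - 1)"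
        using that v assms by (simp add: card_pinj card_Diff_singleton)
      finally show ?thesis .
    qed
    then show "(\<Sum>a\<in>A. card (G v a)) = ?r * (card (D v) * pinj_count (?n - 1) ^ (?r - 1))"
      by simp
  qed simp
  finally have "real (card {E. A_graph A V E \<and> (\<exists>v\<in>V. leaf E v)})
      \<le> (\<Sum>v\<in>V. ?r * (real (card (D v)) * real (pinj_count (?n - 1)) ^ (?r - 1)))"
    by (simp flip: of_nat_sum of_nat_mult of_nat_power)
  also have "\<dots> = ?r * real (pinj_count (?n - 1)) ^ (?r - 1) * (\<Sum>v\<in>V. real (card (D v)))"
    unfolding sum_distrib_left by (intro sum.cong refl) (simp only: mult_ac)
  also have "\<dots> \<le> ?r * (?I ^ (?r - 1) / ?n) * (2 * sqrt ?n * ?I)"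
  proof (intro mult_mono)
    have "real ?n * pinj_count (?n - 1) \<le> ?I"
      using pinj_count_Suc_ge[of "?n - 1"] assms(4) by (simp flip: of_nat_mult)
    then have "(real ?n * pinj_count (?n - 1)) ^ (?r - 1) \<le> ?I ^ (?r - 1)"
      by (intro power_mono) auto
    moreover have "real ?n ^ 1 \<le> real ?n ^ (?r - 1)"
      using assms by (intro power_increasing) auto
    then have "real ?n * real (pinj_count (?n - 1)) ^ (?r - 1) \<le> (real ?n * pinj_count (?n - 1)) ^ (?r - 1)"
      using mult_right_mono[of "real ?n ^ 1" "real ?n ^ (?r - 1)" "real (pinj_count (?n - 1)) ^ (?r - 1)"]
      by (simp add: power_mult_distrib)
    ultimately have "real ?n * real (pinj_count (?n - 1)) ^ (?r - 1) \<le> ?I ^ (?r - 1)" by linarith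
    then show "real (pinj_count (?n - 1)) ^ (?r - 1) \<le> ?I ^ (?r - 1) / ?n"
      using assms(4) by (simp add: field_simps)
    have "card (D v) \<le> card {f \<in> pinj V. v \<notin> Range f} + card {f \<in> pinj V. v \<notin> Domain f}" for v
    proof -
      have Dv: "D v = {f \<in> pinj V. v \<notin> Range f} \<union> {f \<in> pinj V. v \<notin> Domain f}"
        unfolding D_def by blast
      show ?thesis unfolding Dv by (rule card_Un_le)
    qed
    then have "(\<Sum>v\<in>V. real (card (D v)))
        \<le> (\<Sum>v\<in>V. real (card {f \<in> pinj V. v \<notin> Range f}) + real (card {f \<in> pinj V. v \<notin> Domain f}))"
      by (intro sum_mono) (simp flip: of_nat_add)
    also have "\<dots> \<le> sqrt ?n * ?I + sqrt ?n * ?I"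
      unfolding sum.distrib using sum_card_notin_Range[OF assms(3)]
      by (intro add_mono) (simp_all add: card_pinj[OF assms(3)])
    finally show "(\<Sum>v\<in>V. real (card (D v))) \<le> 2 * sqrt ?n * ?I" by (simp add: mult_ac)
  qed (auto intro!: sum_nonneg)
  also have "\<dots> = 2 * ?r / sqrt ?n * (?I * ?I ^ (?r - 1))"
  proof -
    have "sqrt ?n / real ?n = 1 / sqrt ?n"
      using assms(4) by (simp add: divide_simps)
    moreover have "?r * (?I ^ (?r - 1) / ?n) * (2 * sqrt ?n * ?I) = 2 * ?r * (sqrt ?n / real ?n) * (?I * ?I ^ (?r - 1))"
      by simp
    ultimately show ?thesis by simp
  qed
  also have "?I * ?I ^ (?r - 1) = ?I ^ ?r"
    using assms(2) by (simp flip: power_Suc)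
  finally show ?thesis by simp
qed

definition splits_over :: "'v set \<Rightarrow> 'v set \<Rightarrow> ('v \<times> 'v) set \<Rightarrow> bool" where
  "splits_over V U f \<longleftrightarrow> f \<subseteq> U \<times> U \<union> (V - U) \<times> (V - U)"

lemma card_pinj_splitting_le:
  assumes "finite V" "U \<subseteq> V"
  shows "real (card {f \<in> pinj V. splits_over V U f})
    \<le> pinj_density (card U) / (card V choose card U) * pinj_count (card V)"
proof -
  let ?k = "card U" and ?n = "card V"
  have kn: "?k \<le> ?n" using assms by (simp add: card_mono)
  let ?h = "\<lambda>f. (f \<inter> U \<times> U, f \<inter> (V - U) \<times> (V - U))"
  have "card {f \<in> pinj V. splits_over V U f} \<le> card (pinj U \<times> pinj (V - U))"
  proof (rule card_inj_on_le)
    show "inj_on ?h {f \<in> pinj V. splits_over V U f}"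
    proof (rule inj_onI)
      fix f g assume "f \<in> {f \<in> pinj V. splits_over V U f}" "g \<in> {f \<in> pinj V. splits_over V U f}"
        and h: "?h f = ?h g"
      then have "f = fst (?h f) \<union> snd (?h f)" "g = fst (?h g) \<union> snd (?h g)"
        unfolding splits_over_def by auto
      then show "f = g" using h by simp
    qed
    show "?h ` {f \<in> pinj V. splits_over V U f} \<subseteq> pinj U \<times> pinj (V - U)"
    proof (rule image_subsetI)
      fix f assume "f \<in> {f \<in> pinj V. splits_over V U f}"
      then have "f \<in> pinj V" by simp
      then have "f \<inter> W \<times> W \<in> pinj W" for W
        using pinj_restrict[OF pinj_subset, of f V "f \<inter> W \<times> W" W] by simp
      then show "?h f \<in> pinj U \<times> pinj (V - U)" by simp
    qed
    show "finite (pinj U \<times> pinj (V - U))"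
      using assms finite_subset by (auto intro!: finite_pinj)
  qed
  also have "\<dots> = pinj_count ?k * pinj_count (?n - ?k)"
    using assms finite_subset[OF assms(2,1)] by (simp add: card_cartesian_product card_pinj card_Diff_subset)
  finally have "real (card {f \<in> pinj V. splits_over V U f}) \<le> real (pinj_count ?k) * real (pinj_count (?n - ?k))"
    by (simp flip: of_nat_mult)
  also have "\<dots> = fact ?k * fact (?n - ?k) * (pinj_density ?k * pinj_density (?n - ?k))"
    by (simp add: pinj_count_eq_density)
  also have "\<dots> \<le> fact ?k * fact (?n - ?k) * (pinj_density ?k * pinj_density ?n)"
    using pinj_density_pos[of ?k] by (intro mult_left_mono pinj_density_mono) auto
  also have "\<dots> = pinj_density ?k / (?n choose ?k) * (fact ?n * pinj_density ?n)"
    using kn by (simp add: binomial_fact[of ?k ?n, where 'a = real])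
  finally show ?thesis by (simp add: pinj_count_eq_density)
qed

lemma disconnected_splits:
  assumes "finite V" "A_graph A V E" "\<not> connected_graph V E"
  obtains U where "U \<subseteq> V" "U \<noteq> {}" "2 * card U \<le> card V" "\<And>a. splits_over V U (label_edges E a)"
proof -
  obtain x y where xy: "x \<in> V" "y \<in> V" "(x, y) \<notin> (adjacent E)\<^sup>*"
    using assms(3) by (auto simp: connected_graph_def)
  define R where "R = {z \<in> V. (x, z) \<in> (adjacent E)\<^sup>*}"
  have E: "E \<subseteq> V \<times> A \<times> V" using assms(2) by (simp add: A_graph_def)
  have "u \<in> R \<longleftrightarrow> v \<in> R" if "(u, a, v) \<in> E" for u a v
  proof -
    have "(u, v) \<in> adjacent E" "(v, u) \<in> adjacent E" "u \<in> V" "v \<in> V"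
      using that E by (auto simp: adjacent_def)
    then show ?thesis unfolding R_def by (auto intro: rtrancl_into_rtrancl)
  qed
  then have splitR: "splits_over V R (label_edges E a)" "splits_over V (V - R) (label_edges E a)" for a
    using E unfolding splits_over_def by (auto simp: label_edges_def)
  have sub: "R \<subseteq> V" unfolding R_def by blast
  have ne: "R \<noteq> {}" "V - R \<noteq> {}" using xy by (auto simp: R_def)
  have "card R + card (V - R) = card V"
    using card_Diff_subset[of R V] sub assms(1) card_mono[OF assms(1) sub] finite_subset by fastforce
  then consider "2 * card R \<le> card V" | "2 * card (V - R) \<le> card V" by linarith
  then show ?thesis
    using that[of R] that[of "V - R"] sub ne splitR by cases auto
qed

text \<open>A union bound over the smaller side \<open>U\<close> of a separation. For each label the
  probability of splitting over \<open>U\<close> is at most \<open>pinj_density k / (n choose k)\<close>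
  with \<open>k = card U\<close>. The factors of two labels beat the \<open>n choose k\<close> choices of
  \<open>U\<close>, and the other labels contribute probabilities that are at most \<open>1\<close>.\<close>

lemma card_disconnected_graphs_le:
  assumes "finite A" "card A \<ge> 2" "finite V"
  shows "card {E. A_graph A V E \<and> \<not> connected_graph V E}
    \<le> (\<Sum>k\<in>{k. 1 \<le> k \<and> 2 * k \<le> card V}. (pinj_density k)\<^sup>2 / (card V choose k)) * pinj_count (card V) ^ card A"
proof -
  let ?n = "card V" and ?r = "card A"
  let ?I = "real (pinj_count ?n)"
  let ?K = "{k. 1 \<le> k \<and> 2 * k \<le> ?n}"
  define S where "S U = {f \<in> pinj V. splits_over V U f}" for U
  define G where "G U = {E. A_graph A V E \<and> (\<forall>a\<in>A. label_edges E a \<in> S U)}" for U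
  define Us where "Us = {U. U \<subseteq> V \<and> card U \<in> ?K}"
  have finK: "finite ?K" by (rule finite_subset[of _ "{..?n}"]) auto
  have finUs: "finite Us" unfolding Us_def using assms(3) by auto
  have "{E. A_graph A V E \<and> \<not> connected_graph V E} \<subseteq> (\<Union>U\<in>Us. G U)"
  proof clarify
    fix E assume E: "A_graph A V E" "\<not> connected_graph V E"
    then obtain U where U: "U \<subseteq> V" "U \<noteq> {}" "2 * card U \<le> ?n" "\<And>a. splits_over V U (label_edges E a)"
      using disconnected_splits[OF assms(3) E] by blast
    have "card U \<ge> 1" using U(1,2) assms(3) by (simp add: Suc_le_eq card_gt_0_iff finite_subset)
    then have "U \<in> Us" using U by (simp add: Us_def)
    moreover have "E \<in> G U" using E(1) U(4) by (simp add: G_def S_def A_graph_iff_label_edges)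
    ultimately show "E \<in> (\<Union>U\<in>Us. G U)" by blast
  qed
  then have "card {E. A_graph A V E \<and> \<not> connected_graph V E} \<le> card (\<Union>U\<in>Us. G U)"
    using finUs finite_A_graphs[OF assms(1,3)] by (intro card_mono) (auto simp: G_def)
  also have "\<dots> \<le> (\<Sum>U\<in>Us. card (G U))" by (rule card_UN_le[OF finUs])
  also have "\<dots> = (\<Sum>U\<in>Us. card (S U) ^ ?r)"
  proof (rule sum.cong)
    fix U
    have "card (G U) = (\<Prod>a\<in>A. card (S U))"
      unfolding G_def by (rule card_A_graphs[OF assms(1)]) (auto simp: S_def)
    then show "card (G U) = card (S U) ^ ?r" by simp
  qed simp
  finally have "real (card {E. A_graph A V E \<and> \<not> connected_graph V E}) \<le> (\<Sum>U\<in>Us. real (card (S U)) ^ ?r)"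
    by (simp flip: of_nat_sum of_nat_power)
  also have "\<dots> \<le> (\<Sum>U\<in>Us. (pinj_density (card U) / (?n choose card U))\<^sup>2 * ?I ^ ?r)"
  proof (rule sum_mono)
    fix U assume "U \<in> Us"
    have r: "?r = 2 + (?r - 2)" using assms(2) by simp
    have SI: "real (card (S U)) \<le> ?I"
      unfolding S_def card_pinj[OF assms(3), symmetric] using finite_pinj[OF assms(3)] by (intro of_nat_mono card_mono) auto
    have "real (card (S U)) ^ ?r = real (card (S U)) ^ 2 * real (card (S U)) ^ (?r - 2)"
      by (subst r) (rule power_add)
    also have "\<dots> \<le> (pinj_density (card U) / (?n choose card U) * ?I)\<^sup>2 * ?I ^ (?r - 2)"
      using card_pinj_splitting_le[OF assms(3), of U] \<open>U \<in> Us\<close> SI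
      by (intro mult_mono power_mono) (auto simp: S_def Us_def)
    also have "\<dots> = (pinj_density (card U) / (?n choose card U))\<^sup>2 * (?I ^ 2 * ?I ^ (?r - 2))"
      by (simp add: power_mult_distrib power_divide)
    also have "?I ^ 2 * ?I ^ (?r - 2) = ?I ^ ?r"
      by (subst (2) r) (rule power_add[symmetric])
    finally show "real (card (S U)) ^ ?r \<le> (pinj_density (card U) / (?n choose card U))\<^sup>2 * ?I ^ ?r" .
  qed
  also have "\<dots> = (\<Sum>k\<in>?K. \<Sum>U\<in>{U \<in> Us. card U = k}. (pinj_density (card U) / (?n choose card U))\<^sup>2 * ?I ^ ?r)"
    by (rule sum.group[symmetric]) (use finUs finK in \<open>auto simp: Us_def\<close>)
  also have "\<dots> = (\<Sum>k\<in>?K. (pinj_density k)\<^sup>2 / (?n choose k) * ?I ^ ?r)"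
  proof (rule sum.cong)
    fix k assume k: "k \<in> ?K"
    have "{U \<in> Us. card U = k} = {U. U \<subseteq> V \<and> card U = k}" using k by (auto simp: Us_def)
    then have "card {U \<in> Us. card U = k} = ?n choose k" using n_subsets[OF assms(3)] by simp
    moreover have "?n choose k > 0" using k by simp
    ultimately show "(\<Sum>U\<in>{U \<in> Us. card U = k}. (pinj_density (card U) / (?n choose card U))\<^sup>2 * ?I ^ ?r)
        = (pinj_density k)\<^sup>2 / (?n choose k) * ?I ^ ?r"
      by (simp add: power_divide power2_eq_square)
  qed simp
  finally show ?thesis by (simp add: sum_distrib_right)
qed

text \<open>Subexponential growth of \<open>pinj_density\<close> against
  \<open>n choose k \<ge> (n / k) ^ k \<ge> (n / k) * 2 ^ (k - 1)\<close>. The base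
  \<open>5 / 4\<close> is chosen because its square is below \<open>2\<close>, which leaves a convergent
  series and a factor \<open>1 / n\<close>.\<close>

lemma disconnected_bound_tendsto_0:
  "(\<lambda>n. \<Sum>k\<in>{k. 1 \<le> k \<and> 2 * k \<le> n}. (pinj_density k)\<^sup>2 / (n choose k)) \<longlonglongrightarrow> 0"
proof -
  obtain C where C: "C > 0" "\<And>n. pinj_density n \<le> C * (5 / 4) ^ n"
    using pinj_density_subexponential[of "5 / 4"] by auto
  have summable: "summable (\<lambda>k. of_nat k * (25 / 32 :: real) ^ k)"
    using geometric_deriv_sums[of "25 / 32 :: real"] summable_mult2[of "\<lambda>n. of_nat (Suc n) * (25 / 32 :: real) ^ n" "25 / 32"]
    by (subst summable_Suc_iff[symmetric]) (auto simp: mult_ac sums_iff)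
  define D where "D = suminf (\<lambda>k. of_nat k * (25 / 32 :: real) ^ k)"
  have bound: "(\<Sum>k\<in>{k. 1 \<le> k \<and> 2 * k \<le> n}. (pinj_density k)\<^sup>2 / (n choose k)) \<le> 2 * C\<^sup>2 * D / n" for n
  proof -
    have "(\<Sum>k\<in>{k. 1 \<le> k \<and> 2 * k \<le> n}. (pinj_density k)\<^sup>2 / (n choose k))
        \<le> (\<Sum>k\<in>{k. 1 \<le> k \<and> 2 * k \<le> n}. 2 * C\<^sup>2 / n * (k * (25 / 32) ^ k))"
    proof (rule sum_mono)
      fix k assume "k \<in> {k. 1 \<le> k \<and> 2 * k \<le> n}"
      then have k: "1 \<le> k" "2 * k \<le> n" by auto
      obtain j where j: "k = Suc j" using k(1) by (cases k) auto
      have "2 \<le> real n / k" using k by (simp add: field_simps)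
      then have "real n / k * 2 ^ j \<le> real n / k * (real n / k) ^ j"
        by (intro mult_left_mono power_mono) auto
      also have "\<dots> = (real n / k) ^ k" unfolding j by simp
      also have "\<dots> \<le> n choose k" using binomial_ge_n_over_k_pow_k[of k n] k by simp
      finally have "real n / k * 2 ^ j \<le> n choose k" .
      moreover have "(pinj_density k)\<^sup>2 \<le> (C * (5 / 4) ^ k)\<^sup>2"
        using C(2) pinj_density_pos[of k] by (intro power_mono) auto
      ultimately have "(pinj_density k)\<^sup>2 / (n choose k) \<le> (C * (5 / 4) ^ k)\<^sup>2 / (real n / k * 2 ^ j)"
        using k by (intro frac_le) auto
      also have "\<dots> = 2 * C\<^sup>2 / n * (k * ((5 / 4)\<^sup>2 / 2) ^ k)"
      proof -
        have "((5 / 4 :: real) ^ k)\<^sup>2 = ((5 / 4)\<^sup>2) ^ k" by (simp flip: power_mult add: mult.commute)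
        moreover have "((5 / 4 :: real)\<^sup>2 / 2) ^ k = ((5 / 4)\<^sup>2) ^ k / (2 * 2 ^ j)"
          unfolding power_divide[of "(5 / 4)\<^sup>2"] j by simp
        ultimately show ?thesis using k by (simp add: power_mult_distrib)
      qed
      finally show "(pinj_density k)\<^sup>2 / (n choose k) \<le> 2 * C\<^sup>2 / n * (k * (25 / 32) ^ k)"
        by (simp add: power2_eq_square)
    qed
    also have "\<dots> = 2 * C\<^sup>2 / n * (\<Sum>k\<in>{k. 1 \<le> k \<and> 2 * k \<le> n}. k * (25 / 32) ^ k)"
      by (simp add: sum_distrib_left)
    also have "\<dots> \<le> 2 * C\<^sup>2 / n * D"
    proof (rule mult_left_mono)
      have "finite {k. 1 \<le> k \<and> 2 * k \<le> n}" by (rule finite_subset[of _ "{..n}"]) auto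
      then show "(\<Sum>k\<in>{k. 1 \<le> k \<and> 2 * k \<le> n}. k * (25 / 32) ^ k) \<le> D"
        unfolding D_def by (intro sum_le_suminf[OF summable]) auto
    qed simp
    finally show ?thesis by simp
  qed
  show ?thesis
  proof (rule real_tendsto_sandwich[OF _ _ tendsto_const])
    show "(\<lambda>n. 2 * C\<^sup>2 * D / real n) \<longlonglongrightarrow> 0" by real_asymp
    show "\<forall>\<^sub>F n in sequentially. 0 \<le> (\<Sum>k\<in>{k. 1 \<le> k \<and> 2 * k \<le> n}. (pinj_density k)\<^sup>2 / real (n choose k))"
      by (intro always_eventually allI sum_nonneg) simp
  qed (use bound in auto)
qed

text \<open>Connected graphs without leaves are admissible for every choice of the base vertex. Hence, for
  large \<open>n\<close>, restricting from all graphs to the admissible ones at most doubles the probability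
  of an event.\<close>

lemma card_connected_leafless_ge:
  assumes "finite A" "card A \<ge> 2"
  shows "eventually (\<lambda>n. real (pinj_count n ^ card A) \<le>
    2 * card {E. A_graph A {..<n} E \<and> connected_graph {..<n} E \<and> (\<forall>v\<in>{..<n}. \<not> leaf E v)}) sequentially"
proof -
  have "(\<lambda>n. 2 * card A / sqrt n) \<longlonglongrightarrow> 0" by real_asymp
  then have "eventually (\<lambda>n. 2 * card A / sqrt n < 1 / 4) sequentially"
    by (rule order_tendstoD) simp
  moreover have "eventually (\<lambda>n. (\<Sum>k\<in>{k. 1 \<le> k \<and> 2 * k \<le> n}. (pinj_density k)\<^sup>2 / (n choose k)) < 1 / 4) sequentially"
    using disconnected_bound_tendsto_0 by (rule order_tendstoD) simp
  ultimately show ?thesis using eventually_gt_at_top[of 0]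
  proof eventually_elim
    case (elim n)
    let ?V = "{..<n}" and ?T = "real (pinj_count n) ^ card A"
    let ?L = "{E. A_graph A ?V E \<and> (\<exists>v\<in>?V. leaf E v)}"
    let ?D = "{E. A_graph A ?V E \<and> \<not> connected_graph ?V E}"
    let ?G = "{E. A_graph A ?V E \<and> connected_graph ?V E \<and> (\<forall>v\<in>?V. \<not> leaf E v)}"
    have "real (card ?L) \<le> 2 * card A / sqrt n * ?T"
      using card_leaf_graphs_le[OF assms, of ?V] elim(3) by simp
    also have "\<dots> \<le> 1 / 4 * ?T" using elim(1) by (intro mult_right_mono) auto
    finally have L: "real (card ?L) \<le> 1 / 4 * ?T" .
    have "real (card ?D) \<le> (\<Sum>k\<in>{k. 1 \<le> k \<and> 2 * k \<le> n}. (pinj_density k)\<^sup>2 / (n choose k)) * ?T"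
      using card_disconnected_graphs_le[OF assms, of ?V] by simp
    also have "\<dots> \<le> 1 / 4 * ?T" using elim(2) by (intro mult_right_mono) auto
    finally have D: "real (card ?D) \<le> 1 / 4 * ?T" .
    have fin: "finite {E. A_graph A ?V E}" by (rule finite_A_graphs[OF assms(1)]) simp
    have "card {E. A_graph A ?V E} \<le> card (?G \<union> ?L \<union> ?D)"
      by (intro card_mono) (auto intro: finite_subset[OF _ fin])
    also have "\<dots> \<le> card ?G + card ?L + card ?D"
      using card_Un_le[of "?G \<union> ?L" ?D] card_Un_le[of ?G ?L] by linarith
    finally have "?T \<le> real (card ?G) + card ?L + card ?D"
      using card_all_A_graphs[OF assms(1), of ?V] by (simp flip: of_nat_add of_nat_power)
    then have "?T \<le> 2 * real (card ?G)" using L D by linarith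
    then show ?case by simp
  qed
qed

section \<open>Words and loops in a labelled graph\<close>

definition inv_word :: "'a word \<Rightarrow> 'a word" where
  "inv_word w = rev (map inv_letter w)"

lemma reduced_append:
  "reduced (u @ v) \<longleftrightarrow> reduced u \<and> reduced v \<and> (u = [] \<or> v = [] \<or> hd v \<noteq> inv_letter (last u))"
  unfolding reduced_def successively_append_iff by blast

lemma inv_letter_inject [simp]: "inv_letter x = inv_letter y \<longleftrightarrow> x = y"
  by (metis inv_letter_idem)

lemma reduced_inv_word:
  assumes "reduced w"
  shows "reduced (inv_word w)"
proof -
  have "successively (\<lambda>x y. y \<noteq> inv_letter x) w" using assms by (simp add: reduced_def)
  then have "successively (\<lambda>x y. x \<noteq> inv_letter y) w"
    by (rule successively_mono) (metis inv_letter_idem)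
  then show ?thesis by (simp add: reduced_def inv_word_def successively_map)
qed

lemma carrier_free_group: "w \<in> carrier (free_group A) \<longleftrightarrow> set w \<subseteq> A \<times> UNIV \<and> reduced w"
  by (simp add: free_group_def)

lemma mult_free_group: "u \<otimes>\<^bsub>free_group A\<^esub> v = foldr lmult u v"
  by (simp add: free_group_def)

lemma one_free_group: "\<one>\<^bsub>free_group A\<^esub> = []"
  by (simp add: free_group_def)

lemma inv_word_in_carrier:
  "w \<in> carrier (free_group A) \<Longrightarrow> inv_word w \<in> carrier (free_group A)"
  using reduced_inv_word[of w] by (auto simp: carrier_free_group inv_word_def inv_letter_def)

lemma inv_free_group:
  assumes "w \<in> carrier (free_group A)"
  shows "inv\<^bsub>free_group A\<^esub> w = inv_word w"
proof (rule group.inv_equality[OF group_free_group _ assms inv_word_in_carrier[OF assms]])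
  have "foldr lmult (inv_word w) (foldr lmult w []) = []"
    unfolding inv_word_def by (rule foldr_lmult_inverse) simp
  then show "inv_word w \<otimes>\<^bsub>free_group A\<^esub> w = \<one>\<^bsub>free_group A\<^esub>"
    using assms by (simp add: mult_free_group one_free_group carrier_free_group foldr_lmult_reduced)
qed

lemma Cons_eq_mult:
  "reduced (l # w) \<Longrightarrow> l # w = [l] \<otimes>\<^bsub>free_group A\<^esub> w"
  by (auto simp: mult_free_group lmult_def reduced_Cons split: list.splits)

lemma letter_in_carrier: "fst l \<in> A \<Longrightarrow> [l] \<in> carrier (free_group A)"
  by (cases l) (simp add: carrier_free_group reduced_Cons)

lemma edge_step_inv: "edge_step E y (inv_letter l) x \<longleftrightarrow> edge_step E x l y"
  by (cases l; cases "snd l") (auto simp: inv_letter_def)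

lemma edge_step_vertices:
  assumes "A_graph A V E" "edge_step E x l y"
  shows "x \<in> V" "y \<in> V" "fst l \<in> A"
  using assms by (cases l; cases "snd l"; auto simp: A_graph_def)+

lemma edge_step_deterministic:
  assumes "A_graph A V E" "edge_step E x l y" "edge_step E x l z"
  shows "y = z"
proof (cases l)
  case (Pair a s)
  then show ?thesis using assms by (cases s) (auto simp: A_graph_def)
qed

lemma labels_path_append:
  "labels_path E x (u @ v) y \<longleftrightarrow> (\<exists>z. labels_path E x u z \<and> labels_path E z v y)"
  by (induction u arbitrary: x) auto

lemma labels_path_deterministic:
  assumes "A_graph A V E" "labels_path E x w y" "labels_path E x w z"
  shows "y = z"
  using assms(2,3)
proof (induction w arbitrary: x)
  case (Cons l w)
  then show ?case using edge_step_deterministic[OF assms(1)] by fastforce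
qed simp

lemma labels_path_inv_word: "labels_path E x w y \<Longrightarrow> labels_path E y (inv_word w) x"
proof (induction w arbitrary: x)
  case (Cons l w)
  then show ?case by (auto simp: inv_word_def labels_path_append edge_step_inv)
qed (simp add: inv_word_def)

lemma labels_path_letters:
  assumes "A_graph A V E" "labels_path E x w y"
  shows "set w \<subseteq> A \<times> UNIV"
  using assms(2)
proof (induction w arbitrary: x)
  case (Cons l w)
  then show ?case using edge_step_vertices(3)[OF assms(1)] by (cases l) fastforce
qed simp

lemma labels_path_vertices:
  assumes "A_graph A V E" "labels_path E x w y" "x \<in> V"
  shows "y \<in> V"
  using assms(2,3)
proof (induction w arbitrary: x)
  case (Cons l w)
  then show ?case using edge_step_vertices(2)[OF assms(1), of x l] by auto
qed simp

text \<open>In an \<open>A\<close>-graph an edge followed by its inverse leads back to where it started, so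
  free cancellation does not change the endpoints of a path.\<close>

lemma labels_path_lmult:
  assumes "A_graph A V E" "labels_path E x (l # w) y"
  shows "labels_path E x (lmult l w) y"
proof (cases "\<exists>ys. w = inv_letter l # ys")
  case True
  then obtain ys where w: "w = inv_letter l # ys" by blast
  then obtain z z' where z: "edge_step E x l z" "edge_step E z (inv_letter l) z'" "labels_path E z' ys y"
    using assms(2) by auto
  then have "z' = x"
    using edge_step_deterministic[OF assms(1), of z "inv_letter l" z' x] by (simp add: edge_step_inv)
  then show ?thesis using z by (simp add: w lmult_def)
next
  case False
  then have "lmult l w = l # w" by (auto simp: lmult_def split: list.splits)
  then show ?thesis using assms(2) by simp
qed

lemma labels_path_foldr_lmult:
  assumes "A_graph A V E" "labels_path E x u z" "labels_path E z v y"
  shows "labels_path E x (foldr lmult u v) y"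
  using assms(2)
proof (induction u arbitrary: x)
  case (Cons l u)
  then obtain x' where x': "edge_step E x l x'" "labels_path E x' u z" by auto
  have "labels_path E x (l # foldr lmult u v) y"
    using x' Cons.IH[OF x'(2)] by auto
  then show ?case using labels_path_lmult[OF assms(1)] by simp
qed (use assms(3) in simp)

lemma labels_path_mult:
  assumes "A_graph A V E" "labels_path E x u z" "labels_path E z v y"
  shows "labels_path E x (u \<otimes>\<^bsub>free_group B\<^esub> v) y"
  using labels_path_foldr_lmult[OF assms] by (simp add: mult_free_group)

lemma reduced_path_exists:
  assumes "A_graph A V E" "connected_graph V E" "x \<in> V" "y \<in> V"
  obtains w where "w \<in> carrier (free_group A)" "labels_path E x w y"
proof -
  have "(x, y) \<in> (adjacent E)\<^sup>*" using assms by (simp add: connected_graph_def)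
  then have "\<exists>w. labels_path E x w y"
  proof (induction rule: rtrancl_induct)
    case base
    then show ?case by (intro exI[of _ "[]"]) simp
  next
    case (step u v)
    then obtain w where w: "labels_path E x w u" by blast
    from step(2) obtain a where "(u, a, v) \<in> E \<or> (v, a, u) \<in> E" by (auto simp: adjacent_def)
    then have "edge_step E u (a, True) v \<or> edge_step E u (a, False) v" by simp
    then obtain l where "edge_step E u l v" by blast
    then show ?case using w by (intro exI[of _ "w @ [l]"]) (auto simp: labels_path_append)
  qed
  then obtain w where w: "labels_path E x w y" by blast
  let ?w = "foldr lmult w []"
  have path: "labels_path E x ?w y"
    using labels_path_foldr_lmult[OF assms(1) w, of "[]" y] by simp
  then show ?thesis
    using that[of ?w] labels_path_letters[OF assms(1) path] by (simp add: carrier_free_group reduced_foldr_lmult)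
qed

text \<open>If \<open>(E, b)\<close> is admissible, this is the subgroup whose Stallings graph it is.\<close>

definition loop_group :: "'a set \<Rightarrow> ('v \<times> 'a \<times> 'v) set \<Rightarrow> 'v \<Rightarrow> 'a word set" where
  "loop_group A E b = {u \<in> carrier (free_group A). labels_path E b u b}"

lemma subgroup_loop_group:
  assumes "A_graph A V E"
  shows "subgroup (loop_group A E b) (free_group A)"
proof (rule group.subgroupI[OF group_free_group])
  show "loop_group A E b \<subseteq> carrier (free_group A)" by (auto simp: loop_group_def)
  have "[] \<in> loop_group A E b" by (simp add: loop_group_def carrier_free_group)
  then show "loop_group A E b \<noteq> {}" by blast
  show "inv\<^bsub>free_group A\<^esub> u \<in> loop_group A E b" if "u \<in> loop_group A E b" for u
    using that inv_word_in_carrier labels_path_inv_word by (auto simp: loop_group_def inv_free_group)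
  show "u \<otimes>\<^bsub>free_group A\<^esub> v \<in> loop_group A E b" if "u \<in> loop_group A E b" "v \<in> loop_group A E b" for u v
    using that labels_path_mult[OF assms] group_free_group[of A]
    by (auto simp: loop_group_def intro!: monoid.m_closed group.is_monoid)
qed

text \<open>Choose a path \<open>p x\<close> from \<open>b\<close> to every vertex \<open>x\<close>, the
  trivial one for \<open>x = b\<close>. Closing up each of the finitely many edges with these paths gives
  loops that generate, because a loop is the product of the closed-up edges that it traverses.\<close>

lemma finitely_generated_loop_group:
  assumes "finite A" "finite V" "A_graph A V E" "connected_graph V E" "b \<in> V"
  shows "finitely_generated_subgroup (free_group A) (loop_group A E b)"
proof -
  interpret G: group "free_group A" by (rule group_free_group)
  have "\<exists>p. \<forall>x\<in>V. p x \<in> carrier (free_group A) \<and> labels_path E b (p x) x"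
    using reduced_path_exists[OF assms(3,4,5)] by (intro bchoice) blast
  then obtain q where q: "\<And>x. x \<in> V \<Longrightarrow> q x \<in> carrier (free_group A)" "\<And>x. x \<in> V \<Longrightarrow> labels_path E b (q x) x"
    by blast
  \<comment> \<open>The path to \<open>b\<close> itself has to be trivial for loops at \<open>b\<close> to come out unconjugated.\<close>
  define p where "p = q(b := [])"
  have p: "p x \<in> carrier (free_group A)" "labels_path E b (p x) x" if "x \<in> V" for x
    using q that by (auto simp: p_def carrier_free_group)
  define gen where "gen = (\<lambda>(x, l, y). p x \<otimes>\<^bsub>free_group A\<^esub> [l] \<otimes>\<^bsub>free_group A\<^esub> inv\<^bsub>free_group A\<^esub> p y)"
  define S where "S = gen ` {(x, l, y). edge_step E x l y}"
  have "{(x, l, y). edge_step E x l y} \<subseteq> V \<times> (A \<times> UNIV) \<times> V"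
    using edge_step_vertices[OF assms(3)] by (auto simp: mem_Times_iff)
  then have finS: "finite S"
    unfolding S_def using assms(1,2) finite_subset by (intro finite_imageI) fastforce
  have gen: "gen (x, l, y) \<in> loop_group A E b" if "edge_step E x l y" for x l y
  proof -
    have x: "x \<in> V" and y: "y \<in> V" and l: "[l] \<in> carrier (free_group A)"
      using edge_step_vertices[OF assms(3) that] by (auto intro: letter_in_carrier)
    have "labels_path E b (p x \<otimes>\<^bsub>free_group A\<^esub> [l]) y"
      using labels_path_mult[OF assms(3) p(2)[OF x]] that by simp
    moreover have "labels_path E y (inv\<^bsub>free_group A\<^esub> p y) b"
      using labels_path_inv_word[OF p(2)[OF y]] p(1)[OF y] by (simp add: inv_free_group)
    ultimately show ?thesis
      using labels_path_mult[OF assms(3)] p(1)[OF x] p(1)[OF y] l by (auto simp: loop_group_def gen_def)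
  qed
  then have SH: "S \<subseteq> loop_group A E b" by (auto simp: S_def)
  then have SG: "S \<subseteq> carrier (free_group A)" by (auto simp: loop_group_def)
  have key: "p x \<otimes>\<^bsub>free_group A\<^esub> u \<in> generate (free_group A) S"
    if "labels_path E x u b" "u \<in> carrier (free_group A)" "x \<in> V" for x u
    using that
  proof (induction u arbitrary: x)
    case Nil
    then show ?case
      using generate.one[of "free_group A" S] by (simp add: p_def mult_free_group one_free_group)
  next
    case (Cons l u)
    then obtain y where y: "edge_step E x l y" "labels_path E y u b" by auto
    have red: "reduced (l # u)" using Cons.prems(2) by (simp add: carrier_free_group)
    then have u: "u \<in> carrier (free_group A)" using Cons.prems(2) by (simp add: carrier_free_group reduced_Cons)
    have yV: "y \<in> V" and l: "[l] \<in> carrier (free_group A)"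
      using edge_step_vertices[OF assms(3) y(1)] by (auto intro: letter_in_carrier)
    have "inv\<^bsub>free_group A\<^esub> p y \<otimes>\<^bsub>free_group A\<^esub> (p y \<otimes>\<^bsub>free_group A\<^esub> u) = u"
      using p(1)[OF yV] u by (simp flip: G.m_assoc)
    then have eq: "p x \<otimes>\<^bsub>free_group A\<^esub> (l # u) = gen (x, l, y) \<otimes>\<^bsub>free_group A\<^esub> (p y \<otimes>\<^bsub>free_group A\<^esub> u)"
      unfolding Cons_eq_mult[OF red, of A] gen_def
      using p(1)[OF Cons.prems(3)] p(1)[OF yV] l u by (simp add: G.m_assoc)
    have "gen (x, l, y) \<in> generate (free_group A) S"
      using y(1) by (intro generate.incl) (auto simp: S_def)
    then show ?case
      unfolding eq using Cons.IH[OF y(2) u yV] by (rule generate.eng)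
  qed
  have "loop_group A E b = generate (free_group A) S"
  proof
    show "loop_group A E b \<subseteq> generate (free_group A) S"
    proof
      fix u assume "u \<in> loop_group A E b"
      then show "u \<in> generate (free_group A) S"
        using key[of b u] assms(5) by (simp add: loop_group_def p_def mult_free_group)
    qed
    show "generate (free_group A) S \<subseteq> loop_group A E b"
      by (rule G.generate_subgroup_incl[OF SH subgroup_loop_group[OF assms(3)]])
  qed
  then show ?thesis
    unfolding finitely_generated_subgroup_def using finS SG by blast
qed

text \<open>For \<open>l = inv_letter k\<close> this says that a path that enters \<open>x\<close> by
  \<open>k\<close> can be continued without backtracking.\<close>

lemma non_leaf_exit:
  assumes "finite A" "finite V" "A_graph A V E" "\<not> leaf E x"
  obtains m y where "m \<noteq> l" "edge_step E x m y"
proof (rule ccontr)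
  assume none: "\<not> thesis"
  note exit = that
  have only: "m = l" if "edge_step E x m y" for m y using none exit that by blast
  have "E \<subseteq> V \<times> A \<times> V" using assms(3) by (simp add: A_graph_def)
  then have "finite E" using assms(1,2) by (meson finite_SigmaI finite_subset)
  then have fin: "finite {(u, a, v) \<in> E. u = x}" "finite {(u, a, v) \<in> E. v = x}"
    by (auto intro: finite_subset[of _ E])
  obtain a s where l: "l = (a, s)" by (cases l)
  have out: "c = a \<and> s" if "(x, c, v) \<in> E" for c v
    using only[of "(c, True)" v] that l by simp
  have into: "c = a \<and> \<not> s" if "(v, c, x) \<in> E" for c v
    using only[of "(c, False)" v] that l by simp
  have det: "(u, c, v) \<in> E \<Longrightarrow> (u, c, v') \<in> E \<Longrightarrow> v = v'" "(u, c, v) \<in> E \<Longrightarrow> (u', c, v) \<in> E \<Longrightarrow> u = u'" for u u' c v v'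
    using assms(3) unfolding A_graph_def by simp_all
  have "card {(u, a, v) \<in> E. u = x} + card {(u, a, v) \<in> E. v = x} \<le> 1"
  proof (cases s)
    case True
    then have e: "{(u, a, v) \<in> E. v = x} = {}" using into by blast
    have "p = q" if "p \<in> {(u, a, v) \<in> E. u = x}" "q \<in> {(u, a, v) \<in> E. u = x}" for p q
      using that out det(1) by (cases p; cases q) blast
    then have "card {(u, a, v) \<in> E. u = x} \<le> Suc 0"
      using card_le_Suc0_iff_eq[OF fin(1)] by blast
    then show ?thesis unfolding e by simp
  next
    case False
    then have e: "{(u, a, v) \<in> E. u = x} = {}" using out by blast
    have "p = q" if "p \<in> {(u, a, v) \<in> E. v = x}" "q \<in> {(u, a, v) \<in> E. v = x}" for p q
      using that into det(2) by (cases p; cases q) blast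
    then have "card {(u, a, v) \<in> E. v = x} \<le> Suc 0"
      using card_le_Suc0_iff_eq[OF fin(2)] by blast
    then show ?thesis unfolding e by simp
  qed
  then show False using assms(4) by (simp add: leaf_def occurrences_def)
qed

text \<open>This is where admissibility enters. Suppose that some reduced path arrives at a vertex
  \<open>x\<close> from which it cannot be continued to a reduced loop. As \<open>x\<close> is not a leaf, the
  path can be prolonged by an edge to a vertex \<open>y\<close>, and the same defect persists there. Moreover
  every reduced path from \<open>b\<close> to \<open>y\<close> has to use this very edge last, since otherwise
  one could return along its inverse; so \<open>y\<close> is strictly farther from \<open>b\<close> than
  \<open>x\<close>. In a finite graph this cannot go on.\<close>

lemma reduced_path_extends_to_loop:
  assumes "finite A" "admissible A V E b" "reduced w" "labels_path E b w x"
  obtains z where "reduced (w @ z)" "labels_path E b (w @ z) b"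
proof -
  have V: "finite V" "b \<in> V" and E: "A_graph A V E"
    and nonleaf: "\<And>v. v \<in> V \<Longrightarrow> v \<noteq> b \<Longrightarrow> \<not> leaf E v"
    using assms(2) by (auto simp: admissible_def)
  \<comment> \<open>A path that enters \<open>x\<close> by the letter \<open>l\<close> can be continued to a reduced loop.\<close>
  define returns where "returns x l \<longleftrightarrow> (\<exists>z. reduced (l # z) \<and> labels_path E x z b)" for x l
  have returns_base: "returns b l" for l
    unfolding returns_def by (rule exI[of _ "[]"]) (simp add: reduced_Cons)
  define S where "S = {x. \<exists>w l. reduced (w @ [l]) \<and> labels_path E b (w @ [l]) x \<and> \<not> returns x l}"
  \<comment> \<open>The distance from \<open>b\<close>, measured along reduced paths.\<close>
  define d where "d x = (LEAST n. \<exists>w. reduced w \<and> labels_path E b w x \<and> length w = n)" for x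
  have d_le: "d x \<le> length w" if "reduced w" "labels_path E b w x" for w x
    unfolding d_def using that by (intro Least_le) blast
  have d_attained: "\<exists>w. reduced w \<and> labels_path E b w x \<and> length w = d x"
    if "reduced w" "labels_path E b w x" for w x
    unfolding d_def by (rule LeastI_ex) (use that in blast)
  have farther: "\<exists>y\<in>S. d x < d y" if "x \<in> S" for x
  proof -
    obtain w l where w: "reduced (w @ [l])" "labels_path E b (w @ [l]) x" "\<not> returns x l"
      using \<open>x \<in> S\<close> unfolding S_def by blast
    have "x \<in> V" using labels_path_vertices[OF E w(2) V(2)] .
    moreover have "x \<noteq> b" using w(3) returns_base by blast
    ultimately obtain m y where m: "m \<noteq> inv_letter l" "edge_step E x m y"
      using non_leaf_exit[OF assms(1) V(1) E nonleaf] by blast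
    have wm: "reduced ((w @ [l]) @ [m])"
      unfolding reduced_append[of "w @ [l]"] using w(1) m(1) by (simp add: reduced_Cons)
    have path_wm: "labels_path E b ((w @ [l]) @ [m]) y"
      unfolding labels_path_append[of E b "w @ [l]"] using w(2) m(2) by auto
    have y: "\<not> returns y m"
    proof
      assume "returns y m"
      then obtain z where "reduced (m # z)" "labels_path E y z b" by (auto simp: returns_def)
      then have "reduced (l # m # z)" "labels_path E x (m # z) b" using m by (auto simp: reduced_Cons)
      then show False using w(3) unfolding returns_def by blast
    qed
    obtain v where v: "reduced v" "labels_path E b v y" "length v = d y"
      using d_attained[OF wm path_wm] by blast
    have "v \<noteq> []"
      using v(2) y returns_base[of m] by auto
    then obtain u k where uk: "v = u @ [k]" by (metis append_butlast_last_id)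
    have "k = m"
    proof (rule ccontr)
      assume "k \<noteq> m"
      have "inv_word v = inv_letter k # inv_word u" by (simp add: uk inv_word_def)
      then have "reduced (m # inv_word v)"
        using reduced_inv_word[OF v(1)] \<open>k \<noteq> m\<close> by (simp add: reduced_Cons)
      then show False using y labels_path_inv_word[OF v(2)] unfolding returns_def by blast
    qed
    then obtain x' where x': "labels_path E b u x'" "edge_step E x' m y"
      using v(2) by (auto simp: uk labels_path_append)
    then have "x' = x"
      using m(2) edge_step_deterministic[OF E, of y "inv_letter m" x' x] by (simp add: edge_step_inv)
    then have "d x \<le> length u"
      using d_le[of u x] x'(1) v(1) by (simp add: uk reduced_append)
    then have "d x < d y" using v(3) uk by simp
    moreover have "y \<in> S" unfolding S_def using wm path_wm y by blast
    ultimately show ?thesis by blast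
  qed
  have "S \<subseteq> V" using labels_path_vertices[OF E _ V(2)] by (auto simp: S_def)
  then have "finite S" using V(1) finite_subset by blast
  have "S = {}"
  proof (rule ccontr)
    assume "S \<noteq> {}"
    then have "Max (d ` S) \<in> d ` S" using \<open>finite S\<close> by simp
    then obtain x where x: "x \<in> S" "d x = Max (d ` S)" by auto
    then obtain y where "y \<in> S" "d x < d y" using farther by blast
    moreover have "d y \<le> Max (d ` S)" using \<open>finite S\<close> \<open>y \<in> S\<close> by (intro Max_ge) auto
    ultimately show False using x(2) by simp
  qed
  then have returns: "returns y l" if "reduced (u @ [l])" "labels_path E b (u @ [l]) y" for u l y
    using that unfolding S_def by blast
  show ?thesis
  proof (cases "w = []")
    case True
    then show ?thesis using that[of "[]"] by simp
  next
    case False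
    then obtain u l where w: "w = u @ [l]" by (metis append_butlast_last_id)
    then obtain z where z: "reduced (l # z)" "labels_path E x z b"
      using returns[of u l x] assms(3,4) by (auto simp: returns_def)
    then have "reduced (w @ z)"
      using assms(3) w by (auto simp: reduced_append reduced_Cons)
    then show ?thesis using that[of z] z(2) assms(4) labels_path_append by metis
  qed
qed

section \<open>Uniqueness of the Stallings graph\<close>

lemma A_graph_admissible: "admissible A V E b \<Longrightarrow> A_graph A V E"
  by (simp add: admissible_def)

text \<open>The reduced words readable from the base vertex are the prefixes of the elements of the subgroup,
  hence they depend on the subgroup alone.\<close>

lemma labels_path_transfer:
  assumes "finite A" "admissible A V E b" "A_graph A V' E'"
    and "loop_group A E b = loop_group A E' b'"
    and "w \<in> carrier (free_group A)" "labels_path E b w x"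
  shows "\<exists>x'. labels_path E' b' w x'"
proof -
  have E: "A_graph A V E" using assms(2) by (rule A_graph_admissible)
  obtain z where z: "reduced (w @ z)" "labels_path E b (w @ z) b"
    using reduced_path_extends_to_loop[OF assms(1,2) _ assms(6)] assms(5) by (auto simp: carrier_free_group)
  then have "w @ z \<in> loop_group A E b"
    using labels_path_letters[OF E z(2)] by (simp add: loop_group_def carrier_free_group)
  then have "w @ z \<in> loop_group A E' b'" using assms(4) by simp
  then have "labels_path E' b' (w @ z) b'" by (simp add: loop_group_def)
  then show ?thesis by (auto simp: labels_path_append)
qed

text \<open>The subgroup also decides when two words lead to the same vertex.\<close>

lemma same_endpoint_iff:
  assumes "A_graph A V E"
    and u: "u \<in> carrier (free_group A)" "labels_path E b u x"
    and v: "v \<in> carrier (free_group A)" "labels_path E b v y"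
  shows "x = y \<longleftrightarrow> u \<otimes>\<^bsub>free_group A\<^esub> inv\<^bsub>free_group A\<^esub> v \<in> loop_group A E b"
proof
  interpret G: group "free_group A" by (rule group_free_group)
  show "u \<otimes>\<^bsub>free_group A\<^esub> inv\<^bsub>free_group A\<^esub> v \<in> loop_group A E b" if "x = y"
    using labels_path_mult[OF assms(1) u(2)] labels_path_inv_word[OF v(2)] that u(1) v(1)
    by (simp add: loop_group_def flip: inv_free_group[OF v(1)])
  assume "u \<otimes>\<^bsub>free_group A\<^esub> inv\<^bsub>free_group A\<^esub> v \<in> loop_group A E b"
  then have "labels_path E b (u \<otimes>\<^bsub>free_group A\<^esub> inv\<^bsub>free_group A\<^esub> v \<otimes>\<^bsub>free_group A\<^esub> v) y"
    using labels_path_mult[OF assms(1) _ v(2)] by (simp add: loop_group_def)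
  then have "labels_path E b u y" using u(1) v(1) by (simp add: G.m_assoc)
  then show "x = y" using labels_path_deterministic[OF assms(1) u(2)] by simp
qed

definition map_graph :: "('v \<Rightarrow> 'w) \<Rightarrow> ('v \<times> 'a \<times> 'v) set \<Rightarrow> ('w \<times> 'a \<times> 'w) set" where
  "map_graph h E = (\<lambda>(x, a, y). (h x, a, h y)) ` E"

lemma map_graphI: "(x, a, y) \<in> E \<Longrightarrow> (h x, a, h y) \<in> map_graph h E"
  by (force simp: map_graph_def)

text \<open>A vertex is sent to the endpoint, in the other graph, of any reduced word that leads to it; this
  is well defined because the subgroup decides when two words lead to the same vertex.\<close>

lemma endpoint_map_exists:
  assumes "finite A" "admissible A V E b" "A_graph A V' E'"
    and "loop_group A E b = loop_group A E' b'"
  obtains h where "\<And>w x. w \<in> carrier (free_group A) \<Longrightarrow> labels_path E b w x \<Longrightarrow> labels_path E' b' w (h x)"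
proof -
  have E: "A_graph A V E" using assms(2) by (rule A_graph_admissible)
  define h where
    "h x = (SOME x'. \<exists>w \<in> carrier (free_group A). labels_path E b w x \<and> labels_path E' b' w x')" for x
  have "labels_path E' b' w (h x)" if w: "w \<in> carrier (free_group A)" "labels_path E b w x" for w x
  proof -
    obtain x' where x': "labels_path E' b' w x'"
      using labels_path_transfer[OF assms w] by blast
    then have "\<exists>v \<in> carrier (free_group A). labels_path E b v x \<and> labels_path E' b' v (h x)"
      unfolding h_def by (intro someI_ex[of "\<lambda>x'. \<exists>v \<in> carrier (free_group A). labels_path E b v x \<and> labels_path E' b' v x'"])
        (use w in blast)
    then obtain v where v: "v \<in> carrier (free_group A)" "labels_path E b v x" "labels_path E' b' v (h x)"
      by blast
    have "x' = h x"
      using same_endpoint_iff[OF E w v(1,2)] same_endpoint_iff[OF assms(3) w(1) x' v(1,3)] assms(4) by simp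
    then show ?thesis using x' by simp
  qed
  then show ?thesis using that by blast
qed

text \<open>An edge from \<open>x\<close> either prolongs the reduced word \<open>w\<close> that leads to
  \<open>x\<close> or cancels its last letter. In both cases it can be read off from paths starting at the
  base vertex, which the map \<open>h\<close> preserves.\<close>

lemma map_graph_subset:
  assumes "admissible A V E b" "A_graph A V' E'"
    and h: "\<And>w x. w \<in> carrier (free_group A) \<Longrightarrow> labels_path E b w x \<Longrightarrow> labels_path E' b' w (h x)"
  shows "map_graph h E \<subseteq> E'"
proof -
  have E: "A_graph A V E" and conn: "connected_graph V E" and b: "b \<in> V"
    using assms(1) by (auto simp: admissible_def)
  have "(h x, a, h y) \<in> E'" if xy: "(x, a, y) \<in> E" for x a y
  proof -
    let ?l = "(a, True)"
    have step: "edge_step E x ?l y" using xy by simp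
    have x: "x \<in> V" and a: "a \<in> A" using edge_step_vertices[OF E step] by auto
    obtain w where w: "w \<in> carrier (free_group A)" "labels_path E b w x"
      using reduced_path_exists[OF E conn b x] by blast
    have "edge_step E' (h x) ?l (h y)"
    proof (cases "w \<noteq> [] \<and> last w = inv_letter ?l")
      case True
      then obtain u where u: "w = u @ [inv_letter ?l]" by (metis append_butlast_last_id)
      then obtain y' where y': "labels_path E b u y'" "edge_step E y' (inv_letter ?l) x"
        using w(2) by (auto simp: labels_path_append)
      then have "y' = y" using edge_step_deterministic[OF E step, of y'] by (simp only: edge_step_inv)
      then have "labels_path E' b' u (h y)"
        using y'(1) w(1) by (intro h) (auto simp: carrier_free_group u reduced_append)
      moreover obtain z where "labels_path E' b' u z" "edge_step E' z (inv_letter ?l) (h x)"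
        using h[OF w] by (auto simp: u labels_path_append)
      ultimately show ?thesis
        using labels_path_deterministic[OF assms(2)] edge_step_inv by metis
    next
      case False
      then have "w @ [?l] \<in> carrier (free_group A)"
        using w(1) a by (auto simp: carrier_free_group reduced_append reduced_Cons)
      moreover have "labels_path E b (w @ [?l]) y"
        using w(2) xy by (auto simp: labels_path_append)
      ultimately have "labels_path E' b' (w @ [?l]) (h y)" by (rule h)
      then obtain z where z: "labels_path E' b' w z" "edge_step E' z ?l (h y)"
        by (auto simp: labels_path_append)
      then have "z = h x" using labels_path_deterministic[OF assms(2) _ h[OF w]] by simp
      then show ?thesis using z(2) by simp
    qed
    then show ?thesis by simp
  qed
  then show ?thesis by (auto simp: map_graph_def)
qed

text \<open>The endpoint maps in the two directions are inverse to each other.\<close>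

lemma stallings_graph_unique:
  assumes "finite A" "admissible A V E b" "admissible A V' E' b'"
    and "loop_group A E b = loop_group A E' b'"
  obtains h where "bij_betw h V V'" "map_graph h E = E'" "h b = b'"
proof -
  have E: "A_graph A V E" and E': "A_graph A V' E'" and b: "b \<in> V" and b': "b' \<in> V'"
    and conn: "connected_graph V E" and conn': "connected_graph V' E'"
    using assms(2,3) by (auto simp: admissible_def)
  obtain h where h: "\<And>w x. w \<in> carrier (free_group A) \<Longrightarrow> labels_path E b w x \<Longrightarrow> labels_path E' b' w (h x)"
    using endpoint_map_exists[OF assms(1,2) E' assms(4)] by blast
  obtain g where g: "\<And>w x. w \<in> carrier (free_group A) \<Longrightarrow> labels_path E' b' w x \<Longrightarrow> labels_path E b w (g x)"
    using endpoint_map_exists[OF assms(1,3) E assms(4)[symmetric]] by blast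
  have h_in: "h x \<in> V' \<and> g (h x) = x" if "x \<in> V" for x
  proof -
    obtain w where w: "w \<in> carrier (free_group A)" "labels_path E b w x"
      using reduced_path_exists[OF E conn b \<open>x \<in> V\<close>] by blast
    then show ?thesis
      using labels_path_vertices[OF E' h[OF w] b'] labels_path_deterministic[OF E w(2) g[OF w(1) h[OF w]]] by simp
  qed
  have g_in: "g x \<in> V \<and> h (g x) = x" if "x \<in> V'" for x
  proof -
    obtain w where w: "w \<in> carrier (free_group A)" "labels_path E' b' w x"
      using reduced_path_exists[OF E' conn' b' \<open>x \<in> V'\<close>] by blast
    then show ?thesis
      using labels_path_vertices[OF E g[OF w] b] labels_path_deterministic[OF E' w(2) h[OF w(1) g[OF w]]] by simp
  qed
  have "bij_betw h V V'"
    by (rule bij_betw_byWitness[where f' = g]) (use h_in g_in in auto)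
  moreover have "map_graph h E = E'"
  proof
    show "map_graph h E \<subseteq> E'" using map_graph_subset[OF assms(2) E' h] .
    have sub: "map_graph g E' \<subseteq> E" using map_graph_subset[OF assms(3) E g] .
    show "E' \<subseteq> map_graph h E"
    proof clarify
      fix x a y assume e: "(x, a, y) \<in> E'"
      then have "x \<in> V'" "y \<in> V'" using E' by (auto simp: A_graph_def)
      moreover have "(g x, a, g y) \<in> E" using sub e by (force simp: map_graph_def)
      ultimately show "(x, a, y) \<in> map_graph h E"
        using g_in map_graphI[of "g x" a "g y" E h] by simp
    qed
  qed
  moreover have "h b = b'"
    using h[of "[]" b] by (simp add: carrier_free_group)
  ultimately show ?thesis using that by blast
qed

context
  fixes A :: "'a set" and V :: "'v set" and E :: "('v \<times> 'a \<times> 'v) set" and h :: "'v \<Rightarrow> 'w"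
  assumes E: "A_graph A V E" and h: "inj_on h V"
begin

lemma map_graph_iff:
  assumes "x \<in> V" "y \<in> V"
  shows "(h x, a, h y) \<in> map_graph h E \<longleftrightarrow> (x, a, y) \<in> E"
proof
  assume "(h x, a, h y) \<in> map_graph h E"
  then obtain u v where uv: "(u, a, v) \<in> E" "h u = h x" "h v = h y" by (auto simp: map_graph_def)
  then have "u \<in> V" "v \<in> V" using E by (auto simp: A_graph_def)
  then show "(x, a, y) \<in> E" using uv assms h by (metis inj_onD)
qed (force simp: map_graph_def)

lemma map_graphE:
  assumes "(x', a, y') \<in> map_graph h E"
  obtains x y where "x \<in> V" "y \<in> V" "x' = h x" "y' = h y" "(x, a, y) \<in> E"
  using assms E by (auto simp: map_graph_def A_graph_def)

lemma A_graph_map_graph: "A_graph A (h ` V) (map_graph h E)"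
proof -
  have "map_graph h E \<subseteq> h ` V \<times> A \<times> h ` V"
  proof (rule subsetI)
    fix p assume "p \<in> map_graph h E"
    moreover obtain u a v where p: "p = (u, a, v)" by (rule prod_cases3)
    ultimately have "(u, a, v) \<in> map_graph h E" by simp
    then obtain x y where "x \<in> V" "y \<in> V" "u = h x" "v = h y" "(x, a, y) \<in> E" by (rule map_graphE)
    moreover from this have "a \<in> A" using E by (auto simp: A_graph_def)
    ultimately show "p \<in> h ` V \<times> A \<times> h ` V" by (simp add: p)
  qed
  moreover have "v = v'" if m: "(u, a, v) \<in> map_graph h E" "(u, a, v') \<in> map_graph h E" for u a v v'
  proof -
    obtain x y where xy: "x \<in> V" "y \<in> V" "u = h x" "v = h y" "(x, a, y) \<in> E" using map_graphE[OF m(1)] by metis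
    obtain x2 y2 where xy2: "x2 \<in> V" "y2 \<in> V" "u = h x2" "v' = h y2" "(x2, a, y2) \<in> E" using map_graphE[OF m(2)] by metis
    have "x = x2" using inj_onD[OF h, of x x2] xy xy2 by simp
    then have "y = y2" using xy(5) xy2(5) E unfolding A_graph_def by metis
    then show ?thesis using xy(4) xy2(4) by simp
  qed
  moreover have "u = u'" if m: "(u, a, v) \<in> map_graph h E" "(u', a, v) \<in> map_graph h E" for u u' a v
  proof -
    obtain x y where xy: "x \<in> V" "y \<in> V" "u = h x" "v = h y" "(x, a, y) \<in> E" using map_graphE[OF m(1)] by metis
    obtain x2 y2 where xy2: "x2 \<in> V" "y2 \<in> V" "u' = h x2" "v = h y2" "(x2, a, y2) \<in> E" using map_graphE[OF m(2)] by metis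
    have "y = y2" using inj_onD[OF h, of y y2] xy xy2 by simp
    then have "x = x2" using xy(5) xy2(5) E unfolding A_graph_def by metis
    then show ?thesis using xy(3) xy2(3) by simp
  qed
  ultimately show ?thesis unfolding A_graph_def by blast
qed

lemma edge_step_map_graph:
  assumes "x \<in> V" "y \<in> V"
  shows "edge_step (map_graph h E) (h x) l (h y) \<longleftrightarrow> edge_step E x l y"
proof (cases l)
  case (Pair a s)
  then show ?thesis using map_graph_iff assms by (cases s) simp_all
qed

lemma labels_path_map_graph:
  assumes "x \<in> V" "y \<in> V"
  shows "labels_path (map_graph h E) (h x) w (h y) \<longleftrightarrow> labels_path E x w y"
  using assms(1)
proof (induction w arbitrary: x)
  case Nil
  then show ?case using assms(2) h by (auto dest: inj_onD)
next
  case (Cons l w)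
  show ?case
  proof
    assume "labels_path (map_graph h E) (h x) (l # w) (h y)"
    then obtain z' where z': "edge_step (map_graph h E) (h x) l z'" "labels_path (map_graph h E) z' w (h y)" by auto
    then obtain z where z: "z \<in> V" "z' = h z" using edge_step_vertices(2)[OF A_graph_map_graph] by blast
    then show "labels_path E x (l # w) y"
      using z' Cons.IH[OF z(1)] edge_step_map_graph[OF Cons.prems z(1)] by auto
  next
    assume "labels_path E x (l # w) y"
    then obtain z where z: "edge_step E x l z" "labels_path E z w y" by auto
    then have zV: "z \<in> V" using edge_step_vertices(2)[OF E] by blast
    then have "edge_step (map_graph h E) (h x) l (h z)" "labels_path (map_graph h E) (h z) w (h y)"
      using z Cons.IH[OF zV] edge_step_map_graph[OF Cons.prems zV] by simp_all
    then show "labels_path (map_graph h E) (h x) (l # w) (h y)" by auto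
  qed
qed

lemma loop_group_map_graph: "b \<in> V \<Longrightarrow> loop_group A (map_graph h E) (h b) = loop_group A E b"
  by (simp add: loop_group_def labels_path_map_graph)

lemma occurrences_map_graph:
  assumes "x \<in> V"
  shows "occurrences (map_graph h E) (h x) = occurrences E x"
proof -
  let ?m = "\<lambda>(x, a, y). (h x, a, h y)"
  have EV: "E \<subseteq> V \<times> A \<times> V" using E by (simp add: A_graph_def)
  have inj: "inj_on ?m E"
    using h EV by (auto simp: inj_on_def subset_iff)
  have eq: "h u = h x \<longleftrightarrow> u = x" if "u \<in> V" for u
    using inj_on_eq_iff[OF h that assms] .
  have 1: "{(u, a, v) \<in> map_graph h E. u = h x} = ?m ` {(u, a, v) \<in> E. u = x}"
  proof (intro equalityI subsetI)
    fix p assume "p \<in> {(u, a, v) \<in> map_graph h E. u = h x}"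
    then obtain u a v where p: "p = (h u, a, h v)" "(u, a, v) \<in> E" "h u = h x"
      by (auto simp: map_graph_def)
    then have "u = x" using EV eq by blast
    then show "p \<in> ?m ` {(u, a, v) \<in> E. u = x}"
      using p by (intro image_eqI[of _ _ "(u, a, v)"]) auto
  next
    fix p assume "p \<in> ?m ` {(u, a, v) \<in> E. u = x}"
    then show "p \<in> {(u, a, v) \<in> map_graph h E. u = h x}"
      using map_graphI[of _ _ _ E h] by auto
  qed
  have 2: "{(u, a, v) \<in> map_graph h E. v = h x} = ?m ` {(u, a, v) \<in> E. v = x}"
  proof (intro equalityI subsetI)
    fix p assume "p \<in> {(u, a, v) \<in> map_graph h E. v = h x}"
    then obtain u a v where p: "p = (h u, a, h v)" "(u, a, v) \<in> E" "h v = h x"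
      by (auto simp: map_graph_def)
    then have "v = x" using EV eq by blast
    then show "p \<in> ?m ` {(u, a, v) \<in> E. v = x}"
      using p by (intro image_eqI[of _ _ "(u, a, v)"]) auto
  next
    fix p assume "p \<in> ?m ` {(u, a, v) \<in> E. v = x}"
    then show "p \<in> {(u, a, v) \<in> map_graph h E. v = h x}"
      using map_graphI[of _ _ _ E h] by auto
  qed
  show ?thesis
    unfolding occurrences_def 1 2 by (intro arg_cong2[of _ _ _ _ "(+)"] card_image inj_on_subset[OF inj]) auto
qed

lemma connected_map_graph:
  assumes "connected_graph V E"
  shows "connected_graph (h ` V) (map_graph h E)"
proof -
  have "(h x, h y) \<in> (adjacent (map_graph h E))\<^sup>*" if "(x, y) \<in> (adjacent E)\<^sup>*" for x y
    using that
  proof (induction rule: rtrancl_induct)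
    case (step y z)
    then have "(h y, h z) \<in> adjacent (map_graph h E)"
      by (force simp: adjacent_def map_graph_def)
    then show ?case using step(3) by (rule rtrancl_into_rtrancl[rotated])
  qed simp
  then show ?thesis using assms by (auto simp: connected_graph_def)
qed

end

lemma admissible_map_graph:
  assumes "admissible A V E b" "inj_on h V"
  shows "admissible A (h ` V) (map_graph h E) (h b)"
proof -
  have E: "A_graph A V E" using assms(1) by (rule A_graph_admissible)
  have "\<not> leaf (map_graph h E) (h v)" if "v \<in> V" "h v \<noteq> h b" for v
    using assms(1) that occurrences_map_graph[OF E assms(2) that(1)] by (auto simp: admissible_def leaf_def)
  then show ?thesis
    using assms A_graph_map_graph[OF E assms(2)] connected_map_graph[OF E assms(2)]
    by (auto simp: admissible_def)
qed

text \<open>An isomorphism is determined by the image of the base vertex, since all other vertices are reached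
  by paths and paths are deterministic.\<close>

lemma map_graph_rigid:
  assumes "admissible A V E b" "inj_on g V" "inj_on h V"
    and "map_graph g E = map_graph h E" "g b = h b" "x \<in> V"
  shows "g x = h x"
proof -
  have E: "A_graph A V E" and b: "b \<in> V" and conn: "connected_graph V E"
    using assms(1) by (auto simp: admissible_def)
  obtain w where w: "labels_path E b w x" using reduced_path_exists[OF E conn b assms(6)] by blast
  have "labels_path (map_graph g E) (g b) w (g x)"
    using labels_path_map_graph[OF E assms(2) b assms(6)] w by simp
  moreover have "labels_path (map_graph g E) (g b) w (h x)"
    unfolding assms(4,5) using labels_path_map_graph[OF E assms(3) b assms(6)] w by simp
  ultimately show ?thesis
    using labels_path_deterministic[OF A_graph_map_graph[OF E assms(2)]] by blast
qed


section \<open>Counting subgroups by pointed graphs\<close>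

text \<open>All admissible pairs on a fixed vertex set. The base vertex is part of the data so that all
  permutations of the vertices act.\<close>

definition pointed_graphs :: "'a set \<Rightarrow> nat \<Rightarrow> ((nat \<times> 'a \<times> nat) set \<times> nat) set" where
  "pointed_graphs A n = {(E, b). admissible A {..<n} E b}"

lemma finite_pointed_graphs:
  assumes "finite A"
  shows "finite (pointed_graphs A n)"
proof (rule finite_subset)
  show "pointed_graphs A n \<subseteq> Pow ({..<n} \<times> A \<times> {..<n}) \<times> {..<n}"
    by (auto simp: pointed_graphs_def admissible_def A_graph_def)
  show "finite (Pow ({..<n} \<times> A \<times> {..<n}) \<times> {..<n})" using assms by simp
qed

text \<open>A Stallings graph with \<open>n\<close> vertices can be relabelled by \<open>{..<n}\<close>
  without changing its loops.\<close>

lemma subgroups_of_size_eq: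
  assumes "finite A"
  shows "subgroups_of_size A n = (\<lambda>(E, b). loop_group A E b) ` pointed_graphs A n"
proof
  show "subgroups_of_size A n \<subseteq> (\<lambda>(E, b). loop_group A E b) ` pointed_graphs A n"
  proof
    fix H assume "H \<in> subgroups_of_size A n"
    then obtain V :: "nat set" and E b where H: "subgroup H (free_group A)" and
      st: "stallings_graph A V E b H" "card V = n"
      by (auto simp: subgroups_of_size_def)
    have adm: "admissible A V E b" using st(1) by (simp add: stallings_graph_def)
    then have E: "A_graph A V E" and V: "finite V" "b \<in> V" by (auto simp: admissible_def)
    have "H = loop_group A E b"
      using st(1) subgroup.subset[OF H] by (auto simp: stallings_graph_def loop_group_def)
    moreover obtain h where h: "bij_betw h V {..<n}"
      using V(1) st(2) by (metis card_lessThan finite_lessThan finite_same_card_bij)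
    then have inj: "inj_on h V" and im: "h ` V = {..<n}" by (auto simp: bij_betw_def)
    ultimately have "H = loop_group A (map_graph h E) (h b)"
      using loop_group_map_graph[OF E inj V(2)] by simp
    moreover have "(map_graph h E, h b) \<in> pointed_graphs A n"
      using admissible_map_graph[OF adm inj] by (simp add: im pointed_graphs_def)
    ultimately show "H \<in> (\<lambda>(E, b). loop_group A E b) ` pointed_graphs A n" by force
  qed
  show "(\<lambda>(E, b). loop_group A E b) ` pointed_graphs A n \<subseteq> subgroups_of_size A n"
  proof clarify
    fix E b assume "(E, b) \<in> pointed_graphs A n"
    then have adm: "admissible A {..<n} E b" by (simp add: pointed_graphs_def)
    then have E: "A_graph A {..<n} E" "connected_graph {..<n} E" "b \<in> {..<n}" by (auto simp: admissible_def)
    have "stallings_graph A {..<n} E b (loop_group A E b)"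
      using adm by (auto simp: stallings_graph_def loop_group_def)
    then show "loop_group A E b \<in> subgroups_of_size A n"
      using subgroup_loop_group[OF E(1)] finitely_generated_loop_group[OF assms _ E]
      unfolding subgroups_of_size_def by (auto intro!: exI[of _ "{..<n}"])
  qed
qed

text \<open>The permutations of the vertices act on the pointed graphs with a given loop group, freely by
  rigidity and transitively by uniqueness.\<close>

lemma card_pointed_graphs_fibre:
  assumes "finite A" "H \<in> subgroups_of_size A n"
  shows "card {(E, b) \<in> pointed_graphs A n. loop_group A E b = H} = fact n"
proof -
  obtain E b where Eb: "(E, b) \<in> pointed_graphs A n" "H = loop_group A E b"
    using assms(2) by (auto simp: subgroups_of_size_eq[OF assms(1)])
  then have adm: "admissible A {..<n} E b" by (simp add: pointed_graphs_def)
  then have E: "A_graph A {..<n} E" and b: "b \<in> {..<n}" by (auto simp: admissible_def)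
  have "bij_betw (\<lambda>p. (map_graph p E, p b)) {p. p permutes {..<n}} {(E, b) \<in> pointed_graphs A n. loop_group A E b = H}"
  proof (rule bij_betw_imageI)
    show "inj_on (\<lambda>p. (map_graph p E, p b)) {p. p permutes {..<n}}"
    proof (rule inj_onI)
      fix p q assume "p \<in> {p. p permutes {..<n}}" "q \<in> {p. p permutes {..<n}}"
        and eq: "(map_graph p E, p b) = (map_graph q E, q b)"
      then have pq: "p permutes {..<n}" "q permutes {..<n}" by auto
      have "p x = q x" for x
      proof (cases "x \<in> {..<n}")
        case True
        then show ?thesis
          using map_graph_rigid[OF adm permutes_inj_on[OF pq(1)] permutes_inj_on[OF pq(2)]] eq by simp
      next
        case False
        then show ?thesis using permutes_not_in[OF pq(1)] permutes_not_in[OF pq(2)] by simp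
      qed
      then show "p = q" by (rule ext)
    qed
    show "(\<lambda>p. (map_graph p E, p b)) ` {p. p permutes {..<n}} = {(E, b) \<in> pointed_graphs A n. loop_group A E b = H}"
    proof (intro equalityI subsetI)
      fix Q assume "Q \<in> (\<lambda>p. (map_graph p E, p b)) ` {p. p permutes {..<n}}"
      then obtain p where p: "p permutes {..<n}" "Q = (map_graph p E, p b)" by auto
      have inj: "inj_on p {..<n}" using permutes_inj_on[OF p(1)] .
      have "admissible A {..<n} (map_graph p E) (p b)"
        using admissible_map_graph[OF adm inj] by (simp add: permutes_image[OF p(1)])
      then show "Q \<in> {(E, b) \<in> pointed_graphs A n. loop_group A E b = H}"
        using loop_group_map_graph[OF E inj b] Eb(2) p(2) by (simp add: pointed_graphs_def)
    next
      fix Q assume "Q \<in> {(E, b) \<in> pointed_graphs A n. loop_group A E b = H}"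
      then obtain E' b' where Q: "Q = (E', b')" "admissible A {..<n} E' b'" "loop_group A E b = loop_group A E' b'"
        using Eb(2) by (auto simp: pointed_graphs_def)
      obtain h where h: "bij_betw h {..<n} {..<n}" "map_graph h E = E'" "h b = b'"
        using stallings_graph_unique[OF assms(1) adm Q(2,3)] by blast
      define p where "p x = (if x \<in> {..<n} then h x else x)" for x
      have "bij_betw p {..<n} {..<n}" using h(1) by (subst bij_betw_cong[of _ _ h]) (auto simp: p_def)
      then have "p permutes {..<n}" by (rule bij_imp_permutes) (auto simp: p_def)
      moreover have "map_graph p E = map_graph h E"
        unfolding map_graph_def using E by (intro image_cong) (auto simp: p_def A_graph_def)
      moreover have "p b = h b" using b by (simp add: p_def)
      ultimately show "Q \<in> (\<lambda>p. (map_graph p E, p b)) ` {p. p permutes {..<n}}"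
        using h(2,3) Q(1) by (intro image_eqI[of _ _ p]) auto
    qed
  qed
  then show ?thesis
    using card_permutations[of "{..<n}" n] by (simp add: bij_betw_same_card)
qed

text \<open>As all fibres have the same size, the uniform distribution on subgroups is the image of the
  uniform distribution on pointed graphs.\<close>

lemma card_pointed_graphs:
  assumes "finite A"
  shows "card {(E, b) \<in> pointed_graphs A n. P (loop_group A E b)} = fact n * card {H \<in> subgroups_of_size A n. P H}"
proof -
  let ?X = "{(E, b) \<in> pointed_graphs A n. P (loop_group A E b)}" and ?S = "{H \<in> subgroups_of_size A n. P H}"
  have finX: "finite ?X" by (rule finite_subset[OF _ finite_pointed_graphs[OF assms]]) auto
  have finS: "finite ?S"
    unfolding subgroups_of_size_eq[OF assms] using finite_pointed_graphs[OF assms] by simp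
  have "card ?X = (\<Sum>H\<in>?S. \<Sum>x\<in>{x \<in> ?X. (\<lambda>(E, b). loop_group A E b) x = H}. 1)"
    unfolding card_eq_sum
    by (rule sum.group[symmetric, OF finX finS]) (auto simp: subgroups_of_size_eq[OF assms])
  also have "\<dots> = (\<Sum>H\<in>?S. fact n)"
  proof (rule sum.cong)
    fix H assume "H \<in> ?S"
    then have "{x \<in> ?X. (\<lambda>(E, b). loop_group A E b) x = H} = {(E, b) \<in> pointed_graphs A n. loop_group A E b = H}"
      by auto
    then show "(\<Sum>x\<in>{x \<in> ?X. (\<lambda>(E, b). loop_group A E b) x = H}. 1) = fact n"
      using card_pointed_graphs_fibre[OF assms] \<open>H \<in> ?S\<close> by simp
  qed simp
  finally show ?thesis by simp
qed

section \<open>Normal closures\<close>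

lemma has_cycle_power_loop:
  assumes "A_graph A V E" "a \<in> A" "has_cycle k (label_edges E a)"
  obtains x where "x \<in> V" "labels_path E x ([(a, True)] [^]\<^bsub>free_group A\<^esub> k) x"
proof -
  let ?g = "[(a, True)]"
  obtain xs where xs: "length xs = k" "cyc xs \<subseteq> label_edges E a" and k: "k > 0"
    using assms(3) by (auto simp: has_cycle_def)
  have edge: "(xs ! i, a, xs ! (Suc i mod k)) \<in> E" if "i < k" for i
    using cyc_nth[of i xs] xs that by (auto simp: label_edges_def)
  have "labels_path E (xs ! 0) (?g [^]\<^bsub>free_group A\<^esub> i) (xs ! (i mod k))" if "i \<le> k" for i
    using that
  proof (induction i)
    case 0
    then show ?case by (simp add: nat_pow_def one_free_group)
  next
    case (Suc i)
    have "labels_path E (xs ! (i mod k)) ?g (xs ! (Suc i mod k))"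
      using edge[of i] Suc.prems by simp
    then show ?case
      using labels_path_mult[OF assms(1) Suc.IH] Suc.prems by (simp add: nat_pow_def)
  qed
  from this[of k] have "labels_path E (xs ! 0) (?g [^]\<^bsub>free_group A\<^esub> k) (xs ! 0)" by simp
  moreover have "xs ! 0 \<in> V" using edge[OF k] assms(1) by (auto simp: A_graph_def)
  ultimately show ?thesis using that by blast
qed

text \<open>A path \<open>p\<close> from \<open>b\<close> to a vertex of the cycle makes
  \<open>p a\<^sup>k p\<inverse>\<close> an element of the subgroup, and normality removes the
  conjugation.\<close>

lemma letter_power_in_normal_subgroup:
  assumes "admissible A V E b" "N \<lhd> free_group A" "loop_group A E b \<subseteq> N"
    and "a \<in> A" "has_cycle k (label_edges E a)"
  shows "[(a, True)] [^]\<^bsub>free_group A\<^esub> k \<in> N"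
proof -
  interpret G: group "free_group A" by (rule group_free_group)
  interpret N: normal N "free_group A" by (rule assms(2))
  have E: "A_graph A V E" "connected_graph V E" "b \<in> V" using assms(1) by (auto simp: admissible_def)
  let ?c = "[(a, True)] [^]\<^bsub>free_group A\<^esub> k"
  have c: "?c \<in> carrier (free_group A)" using letter_in_carrier[of "(a, True)" A] assms(4) by simp
  obtain x where x: "x \<in> V" "labels_path E x ?c x"
    using has_cycle_power_loop[OF E(1) assms(4,5)] by blast
  obtain p where p: "p \<in> carrier (free_group A)" "labels_path E b p x"
    using reduced_path_exists[OF E(1,2,3) x(1)] by blast
  have "labels_path E b (p \<otimes>\<^bsub>free_group A\<^esub> ?c \<otimes>\<^bsub>free_group A\<^esub> inv\<^bsub>free_group A\<^esub> p) b"
    using labels_path_mult[OF E(1) labels_path_mult[OF E(1) p(2) x(2)] labels_path_inv_word[OF p(2)]]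
    by (simp add: inv_free_group[OF p(1)])
  then have "p \<otimes>\<^bsub>free_group A\<^esub> ?c \<otimes>\<^bsub>free_group A\<^esub> inv\<^bsub>free_group A\<^esub> p \<in> N"
    using assms(3) p(1) c by (auto simp: loop_group_def)
  then have "inv\<^bsub>free_group A\<^esub> p \<otimes>\<^bsub>free_group A\<^esub> (p \<otimes>\<^bsub>free_group A\<^esub> ?c \<otimes>\<^bsub>free_group A\<^esub> inv\<^bsub>free_group A\<^esub> p) \<otimes>\<^bsub>free_group A\<^esub> p \<in> N"
    by (rule N.inv_op_closed1[OF p(1)])
  also have "inv\<^bsub>free_group A\<^esub> p \<otimes>\<^bsub>free_group A\<^esub> (p \<otimes>\<^bsub>free_group A\<^esub> ?c \<otimes>\<^bsub>free_group A\<^esub> inv\<^bsub>free_group A\<^esub> p) \<otimes>\<^bsub>free_group A\<^esub> p = ?c"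
  proof -
    have "inv\<^bsub>free_group A\<^esub> p \<otimes>\<^bsub>free_group A\<^esub> (p \<otimes>\<^bsub>free_group A\<^esub> ?c) = ?c"
      using p(1) c by (simp flip: G.m_assoc)
    then show ?thesis using p(1) c by (simp add: G.m_assoc)
  qed
  finally show ?thesis .
qed

lemma (in group) subgroup_coprime_powers:
  assumes "subgroup N G" "g \<in> carrier G" "g [^] (k :: nat) \<in> N" "g [^] (l :: nat) \<in> N" "coprime k l"
  shows "g \<in> N"
proof -
  have "gcd (int k) (int l) = 1" using assms(5) by (simp add: coprime_iff_gcd_eq_1)
  then obtain u v where uv: "u * int k + v * int l = 1" using bezout_int by metis
  have "(g [^] int k) [^] u \<otimes> (g [^] int l) [^] v \<in> N"
    using assms(3,4)
    by (intro subgroup.m_closed[OF assms(1)] subgroup_int_pow_closed[OF assms(1), of "g [^] int _"])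
      (simp_all add: int_pow_int)
  also have "(g [^] int k) [^] u \<otimes> (g [^] int l) [^] v = g [^] (u * int k + v * int l)"
    using assms(2) by (simp add: int_pow_pow int_pow_mult mult.commute)
  finally show ?thesis using assms(2) by (simp add: uv)
qed

lemma letters_generate_free_group:
  assumes "subgroup N (free_group A)" "\<And>a. a \<in> A \<Longrightarrow> [(a, True)] \<in> N"
  shows "N = carrier (free_group A)"
proof
  show "N \<subseteq> carrier (free_group A)" using subgroup.subset[OF assms(1)] .
  have letter: "[l] \<in> N" if "fst l \<in> A" for l
  proof (cases "snd l")
    case True
    then show ?thesis using assms(2)[of "fst l"] that by (cases l) auto
  next
    case False
    have c: "[(fst l, True)] \<in> carrier (free_group A)" using that by (intro letter_in_carrier) simp
    have "inv\<^bsub>free_group A\<^esub> [(fst l, True)] \<in> N"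
      by (rule subgroup.m_inv_closed[OF assms(1) assms(2)[OF that]])
    also have "inv\<^bsub>free_group A\<^esub> [(fst l, True)] = [l]"
      using False by (simp add: inv_free_group[OF c] inv_word_def inv_letter_def prod_eq_iff)
    finally show ?thesis .
  qed
  show "carrier (free_group A) \<subseteq> N"
  proof
    fix w assume "w \<in> carrier (free_group A)"
    then show "w \<in> N"
    proof (induction w)
      case Nil
      then show ?case using subgroup.one_closed[OF assms(1)] by (simp add: one_free_group)
    next
      case (Cons l w)
      then have red: "reduced (l # w)" and "w \<in> carrier (free_group A)" "fst l \<in> A"
        by (auto simp: carrier_free_group reduced_Cons)
      then show ?case
        unfolding Cons_eq_mult[OF red, of A] using Cons.IH letter
        by (intro subgroup.m_closed[OF assms(1)])
    qed
  qed
qed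

lemma normal_closure_loop_group:
  assumes "admissible A V E b" "\<And>a. a \<in> A \<Longrightarrow> coprime_cycles (label_edges E a)"
  shows "normal_closure (free_group A) (loop_group A E b) = carrier (free_group A)"
proof -
  interpret G: group "free_group A" by (rule group_free_group)
  have whole: "N = carrier (free_group A)" if N: "N \<lhd> free_group A" "loop_group A E b \<subseteq> N" for N
  proof (rule letters_generate_free_group)
    show sub: "subgroup N (free_group A)" using N(1) by (rule normal_imp_subgroup)
    fix a assume a: "a \<in> A"
    obtain k l where "coprime k l" "has_cycle k (label_edges E a)" "has_cycle l (label_edges E a)"
      using assms(2)[OF a] by (auto simp: coprime_cycles_def)
    then show "[(a, True)] \<in> N"
      using letter_power_in_normal_subgroup[OF assms(1) N a] a
      by (intro G.subgroup_coprime_powers[OF sub letter_in_carrier]) auto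
  qed
  have "carrier (free_group A) \<lhd> free_group A" by (rule G.normal_self)
  moreover have "loop_group A E b \<subseteq> carrier (free_group A)" by (auto simp: loop_group_def)
  ultimately have "{N. N \<lhd> free_group A \<and> loop_group A E b \<subseteq> N} = {carrier (free_group A)}"
    using whole by blast
  then show ?thesis by (simp add: normal_closure_def)
qed

lemma trivial_presented_group:
  assumes "normal_closure (free_group A) H = carrier (free_group A)"
  shows "trivial_group (presented_group A H)"
proof -
  interpret G: group "free_group A" by (rule group_free_group)
  have "group (free_group A Mod carrier (free_group A))"
    by (rule normal.factorgroup_is_group[OF G.normal_self])
  moreover have "carrier (free_group A Mod carrier (free_group A)) = {carrier (free_group A)}"
    using G.coset_join2[OF _ G.subgroup_self] G.one_closed unfolding FactGroup_def RCOSETS_def by auto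
  ultimately show ?thesis
    by (simp add: presented_group_def assms trivial_group_def FactGroup_def)
qed


section \<open>Generic triviality\<close>

lemma card_subgroups_failing_le:
  assumes "finite A"
    and "\<And>E b. admissible A {..<n} E b \<Longrightarrow> \<forall>a\<in>A. coprime_cycles (label_edges E a) \<Longrightarrow> P (loop_group A E b)"
  shows "fact n * card {H \<in> subgroups_of_size A n. \<not> P H}
    \<le> n * (card A * (card {f \<in> pinj {..<n}. \<not> coprime_cycles f} * pinj_count n ^ (card A - 1)))"
proof -
  let ?B = "{E. A_graph A {..<n} E \<and> (\<exists>a\<in>A. \<not> coprime_cycles (label_edges E a))}"
  have finB: "finite ?B" by (rule finite_subset[OF _ finite_A_graphs[OF assms(1), of "{..<n}"]]) auto
  have "{(E, b) \<in> pointed_graphs A n. \<not> P (loop_group A E b)} \<subseteq> ?B \<times> {..<n}"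
  proof clarify
    fix E b assume "(E, b) \<in> pointed_graphs A n" and fails: "\<not> P (loop_group A E b)"
    then have adm: "admissible A {..<n} E b" by (simp add: pointed_graphs_def)
    then have "\<exists>a\<in>A. \<not> coprime_cycles (label_edges E a)" using assms(2) fails by blast
    then show "E \<in> ?B \<and> b \<in> {..<n}" using adm by (simp add: admissible_def)
  qed
  then have "card {(E, b) \<in> pointed_graphs A n. \<not> P (loop_group A E b)} \<le> card (?B \<times> {..<n})"
    using finB by (intro card_mono) auto
  also have "\<dots> \<le> card A * (card {f \<in> pinj {..<n}. \<not> coprime_cycles f} * pinj_count n ^ (card A - 1)) * n"
    using card_A_graphs_bad_label_le[OF assms(1), of "{..<n}" coprime_cycles] by (simp add: card_cartesian_product)
  finally show ?thesis
    unfolding card_pointed_graphs[OF assms(1), of n "\<lambda>H. \<not> P H"] by (simp add: mult.commute)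
qed

lemma card_subgroups_ge:
  assumes "finite A"
  shows "n * card {E. A_graph A {..<n} E \<and> connected_graph {..<n} E \<and> (\<forall>v\<in>{..<n}. \<not> leaf E v)}
    \<le> fact n * card (subgroups_of_size A n)"
proof -
  let ?C = "{E. A_graph A {..<n} E \<and> connected_graph {..<n} E \<and> (\<forall>v\<in>{..<n}. \<not> leaf E v)}"
  have "?C \<times> {..<n} \<subseteq> pointed_graphs A n"
    by (auto simp: pointed_graphs_def admissible_def)
  then have "card (?C \<times> {..<n}) \<le> card (pointed_graphs A n)"
    by (rule card_mono[OF finite_pointed_graphs[OF assms]])
  also have "\<dots> = fact n * card (subgroups_of_size A n)"
    using card_pointed_graphs[OF assms, of n "\<lambda>_. True"] by simp
  finally show ?thesis by (simp add: card_cartesian_product mult.commute)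
qed

text \<open>Both counts are taken on pointed graphs with \<open>n\<close> choices of the base vertex. The
  factor \<open>2\<close> in \<open>\<epsilon> / (2 * card A)\<close> pays for the restriction to
  admissible graphs, and \<open>card A\<close> for the union bound over the letters.\<close>

lemma generically_of_coprime_cycles:
  assumes "finite A" "card A \<ge> 2"
    and good: "\<And>(n :: nat) E b. admissible A {..<n} E b \<Longrightarrow> \<forall>a\<in>A. coprime_cycles (label_edges E a) \<Longrightarrow> P (loop_group A E b)"
  shows "generically A P"
proof -
  let ?S = "subgroups_of_size A"
  have finS: "finite (?S n)" for n
    unfolding subgroups_of_size_eq[OF assms(1)] using finite_pointed_graphs[OF assms(1)] by simp
  have bound: "eventually (\<lambda>n. card (?S n) > 0 \<and> real (card {H \<in> ?S n. \<not> P H}) \<le> \<epsilon> * card (?S n)) sequentially"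
    if "\<epsilon> > 0" for \<epsilon> :: real
  proof -
    have pos: "\<epsilon> / (2 * card A) > 0" using assms(2) that by simp
    show ?thesis
      using card_not_coprime_cycles[OF pos] card_connected_leafless_ge[OF assms(1,2)] eventually_gt_at_top[of 0]
    proof eventually_elim
      case (elim n)
      let ?I = "real (pinj_count n)" and ?r = "card A"
      let ?C = "{E. A_graph A {..<n} E \<and> connected_graph {..<n} E \<and> (\<forall>v\<in>{..<n}. \<not> leaf E v)}"
      let ?Q = "card {f \<in> pinj {..<n}. \<not> coprime_cycles f}"
      have I: "?I > 0" by (simp add: pinj_count_pos)
      have "real n * ?I ^ ?r \<le> real n * (2 * real (card ?C))"
        using elim(2) by (intro mult_left_mono) auto
      also have "\<dots> \<le> 2 * (fact n * real (card (?S n)))"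
        using of_nat_mono[OF card_subgroups_ge[OF assms(1), of n], where 'a = real] by simp
      finally have lower: "real n * ?I ^ ?r \<le> 2 * (fact n * real (card (?S n)))" .
      have "fact n * real (card {H \<in> ?S n. \<not> P H}) \<le> real n * (?r * (real ?Q * ?I ^ (?r - 1)))"
        using of_nat_mono[OF card_subgroups_failing_le[where P = P and n = n, OF assms(1) good], where 'a = real] by simp
      also have "\<dots> \<le> real n * (?r * (\<epsilon> / (2 * ?r) * ?I * ?I ^ (?r - 1)))"
        using elim(1) by (intro mult_left_mono mult_right_mono) auto
      also have "\<dots> = \<epsilon> / 2 * (real n * (?I * ?I ^ (?r - 1)))"
        using assms(2) by simp
      also have "?I * ?I ^ (?r - 1) = ?I ^ ?r"
        using assms(2) by (simp flip: power_Suc)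
      also have "\<epsilon> / 2 * (real n * ?I ^ ?r) \<le> \<epsilon> / 2 * (2 * (fact n * real (card (?S n))))"
        using that by (intro mult_left_mono lower) auto
      also have "\<dots> = fact n * (\<epsilon> * card (?S n))" by simp
      finally have upper: "real (card {H \<in> ?S n. \<not> P H}) \<le> \<epsilon> * card (?S n)"
        by (simp only: mult_le_cancel_left_pos[OF fact_gt_zero])
      have "0 < real n * ?I ^ ?r" using elim(3) I by simp
      then have "0 < 2 * (fact n * real (card (?S n)))" using lower by linarith
      then have "card (?S n) > 0" by (simp add: zero_less_mult_iff)
      then show ?case using upper by simp
    qed
  qed
  show ?thesis
    unfolding generically_def
  proof (rule LIMSEQ_I)
    fix \<epsilon> :: real assume "\<epsilon> > 0"
    then have half: "\<epsilon> / 2 > 0" by simp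
    obtain N where N: "\<And>n. n \<ge> N \<Longrightarrow> card (?S n) > 0 \<and> real (card {H \<in> ?S n. \<not> P H}) \<le> \<epsilon> / 2 * card (?S n)"
      using bound[OF half] unfolding eventually_sequentially by blast
    have "norm (measure_pmf.prob (pmf_of_set (?S n)) {H. P H} - 1) < \<epsilon>" if "n \<ge> N" for n
    proof -
      have ne: "?S n \<noteq> {}" and pos: "real (card (?S n)) > 0" using N[OF that] by auto
      have split: "real (card (?S n)) = card (?S n \<inter> {H. P H}) + card {H \<in> ?S n. \<not> P H}"
      proof -
        have "?S n = (?S n \<inter> {H. P H}) \<union> {H \<in> ?S n. \<not> P H}" by blast
        then have "card (?S n) = card (?S n \<inter> {H. P H}) + card {H \<in> ?S n. \<not> P H}"
          using finS[of n] by (subst card_Un_disjoint[symmetric]) auto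
        then show ?thesis by simp
      qed
      have "measure_pmf.prob (pmf_of_set (?S n)) {H. P H} = card (?S n \<inter> {H. P H}) / card (?S n)"
        by (rule measure_pmf_of_set[OF ne finS])
      then have "1 - measure_pmf.prob (pmf_of_set (?S n)) {H. P H} = card {H \<in> ?S n. \<not> P H} / card (?S n)"
        using split pos by (simp add: field_simps)
      also have "\<dots> \<le> \<epsilon> / 2"
        using N[OF that] pos by (simp add: pos_divide_le_eq)
      finally have "1 - measure_pmf.prob (pmf_of_set (?S n)) {H. P H} \<le> \<epsilon> / 2" .
      moreover have "measure_pmf.prob (pmf_of_set (?S n)) {H. P H} \<le> 1"
        by (rule measure_pmf.prob_le_1)
      ultimately show ?thesis using \<open>\<epsilon> > 0\<close>
        unfolding real_norm_def abs_less_iff by (intro conjI; linarith)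
    qed
    then show "\<exists>N. \<forall>n\<ge>N. norm (measure_pmf.prob (pmf_of_set (?S n)) {H. P H} - 1) < \<epsilon>" by blast
  qed
qed

theorem theorem6p1:
  fixes A :: "'a set" and r :: nat
  assumes "r \<ge> 2" and "finite A" and "card A = r"
  shows "generically A (\<lambda>H. trivial_group (presented_group A H)) \<and>
         generically A (\<lambda>H. normal_closure (free_group A) H = carrier (free_group A))"
proof
  have r: "card A \<ge> 2" using assms(1,3) by simp
  have nc: "normal_closure (free_group A) (loop_group A E b) = carrier (free_group A)"
    if "admissible A {..<n} E b" "\<forall>a\<in>A. coprime_cycles (label_edges E a)" for n :: nat and E b
    using normal_closure_loop_group[OF that(1)] that(2) by blast
  show "generically A (\<lambda>H. trivial_group (presented_group A H))"
    by (rule generically_of_coprime_cycles[OF assms(2) r,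
          where P = "\<lambda>H. trivial_group (presented_group A H)"])
      (rule trivial_presented_group[OF nc])
  show "generically A (\<lambda>H. normal_closure (free_group A) H = carrier (free_group A))"
    by (rule generically_of_coprime_cycles[OF assms(2) r,
          where P = "\<lambda>H. normal_closure (free_group A) H = carrier (free_group A)"]) (rule nc)
qed

end
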